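(* Let $n\ge 1$ and let $f:\mathbb R^n\to\mathbb R$ satisfy the standing assumptions (A1)–(A3) stated in the context. Let $0<T_{\max}<\infty$, let $x:(0,T_{\max})\to\mathbb R^n$ be a nondegenerate local minimizing branch, and assume that $x_t\to\bar x$ as $t\to T_{\max}^-$ for some $\bar x\in\mathbb R^n$. Then the following are equivalent: \begin{enumerate} \item[(i)] The branch extends across $T_{\max}$ as a nondegenerate local minimizing branch, i.e. there exist $\varepsilon>0$ and a nondegenerate local minimizing branch $\widetilde x:(0,T_{\max}+\varepsilon)\to\mathbb R^n$ with $\widetilde x_t=x_t$ for all $t\in(0,T_{\max})$. \item[(ii)] The Hessian remains uniformly nondegenerate near $T_{\max}$, namely $$\liminf_{t\to T_{\max}^-}\lambda_{\min}\bigl(\nabla_x^2(P_tf)(x_t)\bigr)>0.$$ \end{enumerate} In particular, if the branch is maximal, then $$\liminf_{t\to T_{\max}^-}\lambda_{\min}\bigl(\nabla_x^2(P_tf)(x_t)\bigr)=0.$$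
   Context: Notation: $\|\cdot\|_2$ is the Euclidean norm on $\mathbb R^n$ and $B_\rho(0)=\{x:\|x\|_2<\rho\}$. For $t>0$ the heat kernel is $G_t(y)=\frac{1}{(4\pi t)^{n/2}}e^{-\|y\|_2^2/(4t)}$, and the heat-kernel regularization of $f$ is $(P_tf)(x)=\int_{\mathbb R^n}G_t(x-y)f(y)\,dy$. $\nabla_x,\nabla_x^2$ denote the gradient and Hessian in $x$, $\lambda_{\min}$ the smallest eigenvalue of a symmetric matrix, and $A\succ0$ means $A$ is positive definite. For $a\in[1,2]$, $\Phi_a(x)=\sum_{i=1}^n|x_i|^a$. Definitions: for an interval $J\subset(0,\infty)$, a critical-point branch of $P_tf$ on $J$ is a map $x\in C^1(J;\mathbb R^n)$ with $\nabla_x(P_tf)(x_t)=0$ for all $t\in J$. It is a nondegenerate local minimizing branch if moreover $\nabla_x^2(P_tf)(x_t)\succ0$ for all $t\in J$. A nondegenerate local minimizing branch $x:(0,T_{\max})\to\mathbb R^n$ is maximal if there do not exist $\varepsilon>0$ and a nondegenerate local minimizing branch $\widetilde x:(0,T_{\max}+\varepsilon)\to\mathbb R^n$ such that $\widetilde x_t=x_t$ for all $t\in(0,T_{\max})$. Standing assumptions on the (Lebesgue measurable) function $f:\mathbb R^n\to\mathbb R$: (A1) Global quadratic lower bound: there is a constant $c>0$ with $f(x)\ge c\|x\|_2^2$ for all $x\in\mathbb R^n$. The distinguished minimizer is at the origin, with $f(0)=0$. (A2) Local leading-order profile: there exist $a\in[1,2]$, $r_0>0$, a function $r:\mathbb R^n\to\mathbb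 R$ and a function $\omega:[0,r_0)\to[0,\infty)$ with $\lim_{\rho\to0^+}\omega(\rho)=0$ such that $f(x)=\Phi_a(x)+r(x)$ and $|r(x)|\le\omega(\|x\|_2)\,\Phi_a(x)$ for all $x\in B_{r_0}(0)$. (A3) Polynomial tail control: there exist constants $C>0$ and $m\ge2$ such that $f(x)\le C(1+\|x\|_2^m)$ for all $x\in\mathbb R^n$. *)

theory Defs
  imports "HOL-Analysis.Analysis"
begin

section \<open>Heat-kernel regularization\<close>

definition heat_kernel :: "real \<Rightarrow> real ^ 'n \<Rightarrow> real" where
  "heat_kernel t y =
     1 / (4 * pi * t) powr (real CARD('n) / 2) * exp (- ((norm y)\<^sup>2 / (4 * t)))"

text \<open>The integral is over \<open>lebesgue\<close> (not \<open>lborel\<close>) because \<open>f\<close> is only assumed Lebesgue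
  measurable.\<close>

definition heat_reg :: "real \<Rightarrow> (real ^ 'n \<Rightarrow> real) \<Rightarrow> real ^ 'n \<Rightarrow> real" where
  "heat_reg t f x = (LINT y|lebesgue. heat_kernel t (x - y) * f y)"


section \<open>Gradient, Hessian, positive definiteness, smallest eigenvalue\<close>

text \<open>\<open>gradient g x\<close> and \<open>hessian g x\<close> are unspecified where \<open>g\<close> is not once, respectively twice,
  differentiable; they are only applied to \<open>heat_reg t f\<close> with \<open>t > 0\<close>, which is smooth for
  measurable \<open>f\<close> of polynomial growth.  The \<open>(i, j)\<close> entry of the Hessian is the \<open>j\<close>-th partial
  derivative of the \<open>i\<close>-th component of the gradient.\<close>

definition gradient :: "(real ^ 'n \<Rightarrow> real) \<Rightarrow> real ^ 'n \<Rightarrow> real ^ 'n" where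
  "gradient g x = (THE D. GDERIV g x :> D)"

definition hessian :: "(real ^ 'n \<Rightarrow> real) \<Rightarrow> real ^ 'n \<Rightarrow> real ^ 'n ^ 'n" where
  "hessian g x = jacobian (gradient g) (at x)"

definition pos_definite :: "real ^ 'n ^ 'n \<Rightarrow> bool" where
  "pos_definite A \<longleftrightarrow> transpose A = A \<and> (\<forall>v. v \<noteq> 0 \<longrightarrow> 0 < v \<bullet> (A *v v))"

text \<open>For symmetric \<open>A\<close> the set of eigenvalues is finite and nonempty, so \<open>Min\<close> is meaningful.\<close>

definition lambda_min :: "real ^ 'n ^ 'n \<Rightarrow> real" where
  "lambda_min A = Min {l. \<exists>v. v \<noteq> 0 \<and> A *v v = l *\<^sub>R v}"


section \<open>Critical-point branches\<close>

text \<open>A branch is a total function of which only the values on \<open>J\<close> matter; derivatives are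
  therefore taken within \<open>J\<close> (one-sided at an endpoint belonging to \<open>J\<close>).  In the gradient
  condition, \<open>GDERIV _ _ :> 0\<close> says that the gradient exists and vanishes.\<close>

definition critical_branch ::
    "(real ^ 'n \<Rightarrow> real) \<Rightarrow> real set \<Rightarrow> (real \<Rightarrow> real ^ 'n) \<Rightarrow> bool" where
  "critical_branch f J x \<longleftrightarrow>
     is_interval J \<and> J \<subseteq> {0<..} \<and>
     (\<exists>x'. (\<forall>t\<in>J. (x has_vector_derivative x' t) (at t within J)) \<and> continuous_on J x') \<and>
     (\<forall>t\<in>J. GDERIV (heat_reg t f) (x t) :> 0)"

definition nondeg_min_branch ::
    "(real ^ 'n \<Rightarrow> real) \<Rightarrow> real set \<Rightarrow> (real \<Rightarrow> real ^ 'n) \<Rightarrow> bool" where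
  "nondeg_min_branch f J x \<longleftrightarrow>
     critical_branch f J x \<and> (\<forall>t\<in>J. pos_definite (hessian (heat_reg t f) (x t)))"

definition extends_across ::
    "(real ^ 'n \<Rightarrow> real) \<Rightarrow> real \<Rightarrow> (real \<Rightarrow> real ^ 'n) \<Rightarrow> bool" where
  "extends_across f T x \<longleftrightarrow>
     (\<exists>\<epsilon>>0. \<exists>y. nondeg_min_branch f {0<..<T + \<epsilon>} y \<and> (\<forall>t\<in>{0<..<T}. y t = x t))"

definition maximal_branch ::
    "(real ^ 'n \<Rightarrow> real) \<Rightarrow> real \<Rightarrow> (real \<Rightarrow> real ^ 'n) \<Rightarrow> bool" where
  "maximal_branch f T x \<longleftrightarrow> nondeg_min_branch f {0<..<T} x \<and> \<not> extends_across f T x"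


section \<open>Standing assumptions on \<open>f\<close>\<close>

definition quadratic_lower_bound :: "(real ^ 'n \<Rightarrow> real) \<Rightarrow> bool" where
  "quadratic_lower_bound f \<longleftrightarrow> (\<exists>c>0. \<forall>x. c * (norm x)\<^sup>2 \<le> f x) \<and> f 0 = 0"

definition Phi :: "real \<Rightarrow> real ^ 'n \<Rightarrow> real" where
  "Phi a x = (\<Sum>i\<in>UNIV. \<bar>x $ i\<bar> powr a)"

text \<open>\<open>\<omega>\<close> is a total function here, but only its values on \<open>[0, r\<^sub>0)\<close> are constrained or used.\<close>

definition local_profile :: "(real ^ 'n \<Rightarrow> real) \<Rightarrow> bool" where
  "local_profile f \<longleftrightarrow>
     (\<exists>a\<in>{1..2}. \<exists>r\<^sub>0>0. \<exists>r :: real ^ 'n \<Rightarrow> real. \<exists>\<omega> :: real \<Rightarrow> real.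
        (\<forall>\<rho>\<in>{0..<r\<^sub>0}. 0 \<le> \<omega> \<rho>) \<and>
        (\<omega> \<longlongrightarrow> 0) (at_right 0) \<and>
        (\<forall>x\<in>ball 0 r\<^sub>0. f x = Phi a x + r x \<and> \<bar>r x\<bar> \<le> \<omega> (norm x) * Phi a x))"

text \<open>The exponent \<open>m\<close> is real, hence \<open>powr\<close>; note \<open>0 powr m = 0\<close>.\<close>

definition polynomial_tail :: "(real ^ 'n \<Rightarrow> real) \<Rightarrow> bool" where
  "polynomial_tail f \<longleftrightarrow>
     (\<exists>C>0. \<exists>m::real. 2 \<le> m \<and> (\<forall>x. f x \<le> C * (1 + norm x powr m)))"

end

theory Submission
  imports Defs "HOL-Probability.Distributions"
begin

text \<open>Expanding the square in the heat kernel gives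
  \<open>P\<^sub>t f (x) = G\<^sub>t(x) L\<^sub>f (1/(4t), x/(2t))\<close> with \<open>L\<^sub>g (s, b) = \<integral> exp (- s |y|\<^sup>2 + b \<bullet> y) g(y) dy\<close>.
  Differentiating \<open>L\<^sub>g\<close> only multiplies \<open>g\<close> by a polynomial, so one differentiation theorem for \<open>L\<^sub>g\<close>
  with \<open>g\<close> of at most exponential growth shows that \<open>\<nabla>P\<^sub>t f\<close> is jointly \<open>C\<^sup>1\<close> in \<open>(t, x)\<close>.
  If the smallest eigenvalue stays bounded away from zero, the Hessian at the limit point is positive
  definite and the implicit function theorem continues the branch; its local uniqueness makes the
  continuation agree with the given branch.  Conversely an extension is continuous at \<open>T\<close>, so
  coercivity of the Hessian there persists nearby.\<close>

section \<open>The smallest eigenvalue of a symmetric matrix\<close>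

lemma symmetric_matrix_inner:
  fixes A :: "real ^ 'n ^ 'n"
  assumes "transpose A = A"
  shows "(A *v u) \<bullet> v = u \<bullet> (A *v v)"
  using assms transpose_matrix_vector[of A u] dot_lmul_matrix[of u A v] by simp

text \<open>Compactness of the unit sphere gives a minimizer \<open>v\<close> of the quadratic form
  there. Its first variation vanishes, which makes \<open>v\<close> an eigenvector whose eigenvalue
  \<mu> is the minimum itself.\<close>

lemma symmetric_min_eigenvalue:
  fixes A :: "real ^ 'n ^ 'n"
  assumes sym: "transpose A = A"
  obtains v \<mu> where "v \<noteq> 0" "A *v v = \<mu> *\<^sub>R v" "\<And>w. \<mu> * (w \<bullet> w) \<le> w \<bullet> (A *v w)"
proof -
  let ?S = "sphere (0 :: real ^ 'n) 1"
  have "continuous_on ?S (\<lambda>w. w \<bullet> (A *v w))"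
    by (intro continuous_intros)
  moreover have "?S \<noteq> {}"
    by (metis DIM_positive less_eq_real_def sphere_eq_empty zero_less_one linorder_not_less)
  ultimately obtain v where v: "v \<in> ?S" "\<And>w. w \<in> ?S \<Longrightarrow> v \<bullet> (A *v v) \<le> w \<bullet> (A *v w)"
    using continuous_attains_inf[of ?S] compact_sphere by blast
  define \<mu> where "\<mu> = v \<bullet> (A *v v)"
  have vv: "v \<bullet> v = 1"
    using v(1) by (simp add: dot_square_norm)
  have le: "\<mu> * (w \<bullet> w) \<le> w \<bullet> (A *v w)" for w
  proof (cases "w = 0")
    case False
    have "\<mu> \<le> (w /\<^sub>R norm w) \<bullet> (A *v (w /\<^sub>R norm w))"
      using v(2)[of "w /\<^sub>R norm w"] False by (simp add: \<mu>_def)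
    also have "\<dots> = (w \<bullet> (A *v w)) / (norm w)\<^sup>2"
      by (simp add: matrix_vector_mult_scaleR power2_eq_square divide_simps)
    finally show ?thesis
      using False by (simp add: pos_le_divide_eq dot_square_norm)
  qed simp
  \<comment> \<open>The first variation of \<open>Q\<close> at its minimum \<open>v\<close> in the direction of the residual \<open>w\<close> must vanish.\<close>
  define w where "w = A *v v - \<mu> *\<^sub>R v"
  define Q where "Q h = h \<bullet> (A *v h) - \<mu> * (h \<bullet> h)" for h
  have Q: "Q (v + e *\<^sub>R w) = 2 * e * (w \<bullet> w) + e\<^sup>2 * Q w" for e
  proof -
    have "v \<bullet> (A *v w) = (A *v v) \<bullet> w"
      by (simp add: symmetric_matrix_inner[OF sym])
    moreover have "(A *v v) \<bullet> w = w \<bullet> w + \<mu> * (v \<bullet> w)"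
      by (simp add: w_def algebra_simps)
    ultimately show ?thesis
      using vv by (simp add: Q_def \<mu>_def[symmetric] algebra_simps matrix_vector_mult_scaleR
        matrix_vector_right_distrib power2_eq_square inner_commute)
  qed
  have pos: "0 \<le> 2 * e * (w \<bullet> w) + e\<^sup>2 * Q w" for e
    using le[of "v + e *\<^sub>R w"] Q[of e] by (simp add: Q_def)
  have "w \<bullet> w = 0"
  proof (rule ccontr)
    assume "w \<bullet> w \<noteq> 0"
    then have ww: "w \<bullet> w > 0" by simp
    have Qw: "Q w \<ge> 0" using le by (simp add: Q_def)
    \<comment> \<open>A negative step of this size lets the linear term outweigh the quadratic one;
      the \<open>+ 1\<close> covers the case \<open>Q w = 0\<close>.\<close>
    define e where "e = - (w \<bullet> w) / (Q w + 1)"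
    have e: "w \<bullet> w = - e * (Q w + 1)"
      using Qw by (simp add: e_def)
    have "2 * e * (w \<bullet> w) + e\<^sup>2 * Q w = e\<^sup>2 * (Q w - 2 * (Q w + 1))"
      unfolding e by (simp add: algebra_simps power2_eq_square)
    also have "\<dots> < 0"
      using ww Qw e by (intro mult_pos_neg) auto
    finally show False using pos[of e] by linarith
  qed
  then show thesis
    using that[of v \<mu>] vv le by (fastforce simp: w_def)
qed

text \<open>The \<open>Min\<close> in \<open>lambda_min\<close> is taken over this set. Eigenvectors
  for distinct eigenvalues are orthogonal and nonzero, so choosing one per eigenvalue is injective
  with a pairwise orthogonal, hence finite, image.\<close>

lemma finite_eigenvalues_symmetric:
  fixes A :: "real ^ 'n ^ 'n"
  assumes sym: "transpose A = A"
  shows "finite {l. \<exists>v. v \<noteq> 0 \<and> A *v v = l *\<^sub>R v}" (is "finite ?E")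
proof -
  have "\<forall>l\<in>?E. \<exists>v. v \<noteq> 0 \<and> A *v v = l *\<^sub>R v"
    by simp
  then obtain V where V: "\<And>l. l \<in> ?E \<Longrightarrow> V l \<noteq> 0 \<and> A *v V l = l *\<^sub>R V l"
    by (meson bchoice)
  have orth: "V l \<bullet> V m = 0" if "l \<in> ?E" "m \<in> ?E" "l \<noteq> m" for l m
    using symmetric_matrix_inner[OF sym, of "V l" "V m"] V[OF that(1)] V[OF that(2)] that(3)
    by simp
  have "inj_on V ?E"
    using V orth by (metis (no_types, lifting) inj_onI inner_eq_zero_iff)
  moreover have "finite (V ` ?E)"
    by (rule pairwise_orthogonal_imp_finite) (auto simp: pairwise_def orthogonal_def intro: orth)
  ultimately show ?thesis
    using finite_imageD by blast
qed

lemma lambda_min_eigenvalue: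
  fixes A :: "real ^ 'n ^ 'n"
  assumes sym: "transpose A = A"
  shows "\<exists>v. v \<noteq> 0 \<and> A *v v = lambda_min A *\<^sub>R v"
proof -
  let ?E = "{l. \<exists>v. v \<noteq> 0 \<and> A *v v = l *\<^sub>R v}"
  obtain v \<mu> where "v \<noteq> 0" "A *v v = \<mu> *\<^sub>R v"
    using symmetric_min_eigenvalue[OF sym] by blast
  then have "?E \<noteq> {}" by blast
  then have "Min ?E \<in> ?E"
    by (intro Min_in finite_eigenvalues_symmetric sym)
  then show ?thesis by (simp add: lambda_min_def)
qed

text \<open>The minimum of the Rayleigh quotient is itself an eigenvalue, so the least eigenvalue
  cannot exceed it.\<close>

lemma lambda_min_le_rayleigh:
  fixes A :: "real ^ 'n ^ 'n"
  assumes "transpose A = A"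
  shows "lambda_min A * (w \<bullet> w) \<le> w \<bullet> (A *v w)"
proof -
  obtain v \<mu> where v: "v \<noteq> 0" "A *v v = \<mu> *\<^sub>R v" "\<And>w. \<mu> * (w \<bullet> w) \<le> w \<bullet> (A *v w)"
    using symmetric_min_eigenvalue[OF assms] by blast
  have "lambda_min A \<le> \<mu>"
    unfolding lambda_min_def using v(1,2) by (intro Min_le finite_eigenvalues_symmetric assms) auto
  then show ?thesis
    using v(3)[of w] by (meson inner_ge_zero mult_right_mono order_trans)
qed

text \<open>It suffices to test the assumed bound on an eigenvector for
  \<open>lambda_min A\<close>.\<close>

lemma lambda_min_ge:
  fixes A :: "real ^ 'n ^ 'n"
  assumes "transpose A = A" and ge: "\<And>w. \<mu> * (w \<bullet> w) \<le> w \<bullet> (A *v w)"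
  shows "\<mu> \<le> lambda_min A"
proof -
  obtain v where "v \<noteq> 0" "A *v v = lambda_min A *\<^sub>R v"
    using lambda_min_eigenvalue[OF assms(1)] by blast
  then show ?thesis
    using ge[of v] by simp
qed

text \<open>Expresses nondegeneracy of a branch through the same quantity that occurs in the limit
  inferior.\<close>

lemma pos_definite_iff_lambda_min:
  fixes A :: "real ^ 'n ^ 'n"
  shows "pos_definite A \<longleftrightarrow> transpose A = A \<and> 0 < lambda_min A"
proof (cases "transpose A = A")
  case True
  obtain v where v: "v \<noteq> 0" "A *v v = lambda_min A *\<^sub>R v"
    using lambda_min_eigenvalue[OF True] by blast
  show ?thesis
  proof
    assume "pos_definite A"
    then have "0 < v \<bullet> (A *v v)" using v(1) by (auto simp: pos_definite_def)
    then show "transpose A = A \<and> 0 < lambda_min A"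
      using True v by (auto simp: zero_less_mult_iff) (smt (verit) inner_ge_zero)
  next
    assume "transpose A = A \<and> 0 < lambda_min A"
    then show "pos_definite A"
      using lambda_min_le_rayleigh[OF True]
      unfolding pos_definite_def by (metis inner_gt_zero_iff less_le_trans mult_pos_pos)
  qed
qed (simp add: pos_definite_def)

section \<open>Gaussian integrals\<close>

text \<open>Exponential rather than polynomial growth: a factor \<open>exp (k |y|)\<close> is absorbed into the linear term
  of the Gaussian exponent, so no estimates on moments are needed.\<close>

definition exp_growth :: "('a::euclidean_space \<Rightarrow> real) \<Rightarrow> bool" where
  "exp_growth g \<longleftrightarrow> g \<in> borel_measurable lebesgue \<and> (\<exists>C k. \<forall>y. \<bar>g y\<bar> \<le> C * exp (k * norm y))"

section \<open>Closure properties of functions of exponential growth\<close>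

lemma exp_growthE:
  assumes "exp_growth g"
  obtains C k where "C \<ge> 0" "k \<ge> 0" "\<And>y. \<bar>g y\<bar> \<le> C * exp (k * norm y)"
proof -
  obtain C k where *: "\<And>y. \<bar>g y\<bar> \<le> C * exp (k * norm y)"
    using assms by (auto simp: exp_growth_def)
  have "\<bar>g y\<bar> \<le> \<bar>C\<bar> * exp (\<bar>k\<bar> * norm y)" for y
    by (rule order_trans[OF *]) (intro mult_mono, auto simp: mult_right_mono)
  then show thesis using that[of "\<bar>C\<bar>" "\<bar>k\<bar>"] by simp
qed

lemma exp_growth_mult:
  assumes "exp_growth g" "exp_growth h"
  shows "exp_growth (\<lambda>y. g y * h y)"
proof -
  obtain C k where g: "C \<ge> 0" "k \<ge> 0" "\<And>y. \<bar>g y\<bar> \<le> C * exp (k * norm y)"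
    using exp_growthE[OF assms(1)] by blast
  obtain D l where h: "D \<ge> 0" "l \<ge> 0" "\<And>y. \<bar>h y\<bar> \<le> D * exp (l * norm y)"
    using exp_growthE[OF assms(2)] by blast
  have "\<bar>g y * h y\<bar> \<le> (C * D) * exp ((k + l) * norm y)" for y
  proof -
    have "\<bar>g y * h y\<bar> \<le> (C * exp (k * norm y)) * (D * exp (l * norm y))"
      unfolding abs_mult by (intro mult_mono g h) (use g in auto)
    then show ?thesis by (simp add: exp_add algebra_simps)
  qed
  then show ?thesis
    using assms unfolding exp_growth_def by (auto intro: borel_measurable_times)
qed

lemma exp_growth_bounded_by_exp_norm:
  fixes g :: "'a::euclidean_space \<Rightarrow> real"
  assumes "continuous_on UNIV g" "\<And>y. \<bar>g y\<bar> \<le> C * exp (k * norm y)"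
  shows "exp_growth g"
proof -
  have "g \<in> borel_measurable lborel"
    using borel_measurable_continuous_onI[OF assms(1)] by simp
  then show ?thesis
    using assms(2) unfolding exp_growth_def by (auto intro: measurable_completion)
qed

lemma norm_le_exp_norm: "norm y \<le> exp (norm y)"
  using exp_ge_add_one_self[of "norm y"] by linarith

lemma exp_growth_inner: "exp_growth (\<lambda>y::'a::euclidean_space. b \<bullet> y)"
proof (rule exp_growth_bounded_by_exp_norm)
  show "\<bar>b \<bullet> y\<bar> \<le> norm b * exp (1 * norm y)" for y
    using Cauchy_Schwarz_ineq2[of b y] mult_left_mono[OF norm_le_exp_norm[of y], of "norm b"]
    by simp
qed (intro continuous_intros)

lemma exp_growth_norm_square: "exp_growth (\<lambda>y::'a::euclidean_space. (norm y)\<^sup>2)"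
proof (rule exp_growth_bounded_by_exp_norm)
  show "\<bar>(norm y)\<^sup>2\<bar> \<le> 1 * exp (2 * norm y)" for y :: 'a
    using power_mono[OF norm_le_exp_norm[of y], of 2] by (simp add: exp_double)
qed (intro continuous_intros)

lemma exp_growth_const: "exp_growth (\<lambda>y::'a::euclidean_space. c)"
  by (rule exp_growth_bounded_by_exp_norm[where C = "\<bar>c\<bar>" and k = 0]) auto

lemma exp_growth_add:
  assumes "exp_growth g" "exp_growth h"
  shows "exp_growth (\<lambda>y. g y + h y)"
proof -
  obtain C k where g: "C \<ge> 0" "k \<ge> 0" "\<And>y. \<bar>g y\<bar> \<le> C * exp (k * norm y)"
    using exp_growthE[OF assms(1)] by blast
  obtain D l where h: "D \<ge> 0" "l \<ge> 0" "\<And>y. \<bar>h y\<bar> \<le> D * exp (l * norm y)"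
    using exp_growthE[OF assms(2)] by blast
  have "\<bar>g y + h y\<bar> \<le> (C + D) * exp ((k + l) * norm y)" for y
  proof -
    have "C * exp (k * norm y) \<le> C * exp ((k + l) * norm y)"
      "D * exp (l * norm y) \<le> D * exp ((k + l) * norm y)"
      using g(1,2) h(1,2) by (auto intro!: mult_left_mono mult_right_mono)
    then show ?thesis
      using g(3)[of y] h(3)[of y] by (simp add: algebra_simps) 
  qed
  then show ?thesis
    using assms unfolding exp_growth_def by (auto intro: borel_measurable_add)
qed

text \<open>The Gaussian is a product over the coordinates, and Lebesgue measure is the image of the
  product measure under the coordinate map. Each factor is a multiple of a normal density.\<close>

lemma integrable_gaussian_lborel:
  assumes "s > 0"
  shows "integrable lborel (\<lambda>y::'a::euclidean_space. exp (- s * (norm y)\<^sup>2))"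
proof -
  interpret product_sigma_finite "\<lambda>b::'a. lborel :: real measure" ..
  have one: "integrable lborel (\<lambda>x::real. exp (- s * x\<^sup>2))"
  proof -
    \<comment> \<open>Chosen so that the exponent \<open>1 / (2 * \<sigma>\<^sup>2)\<close> of the
      normal density equals \<open>s\<close>.\<close>
    define \<sigma> where "\<sigma> = 1 / sqrt (2 * s)"
    have "(\<lambda>x. sqrt (2 * pi * \<sigma>\<^sup>2) * normal_density 0 \<sigma> x) = (\<lambda>x::real. exp (- s * x\<^sup>2))"
      using assms by (simp add: normal_density_def \<sigma>_def power_divide fun_eq_iff)
    moreover have "integrable lborel (\<lambda>x. sqrt (2 * pi * \<sigma>\<^sup>2) * normal_density 0 \<sigma> x)"
      using assms by (intro integrable_mult_right integrable_normal_density) (simp add: \<sigma>_def)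
    ultimately show ?thesis by simp
  qed
  have "integrable (\<Pi>\<^sub>M b\<in>(Basis::'a set). lborel) (\<lambda>f. \<Prod>b\<in>(Basis::'a set). exp (- s * (f b)\<^sup>2))"
    by (rule product_integrable_prod) (use one in auto)
  also have "(\<lambda>f. \<Prod>b\<in>(Basis::'a set). exp (- s * (f b)\<^sup>2))
      = (\<lambda>f. exp (- s * (norm (\<Sum>b\<in>(Basis::'a set). f b *\<^sub>R b))\<^sup>2))"
  proof
    fix f :: "'a \<Rightarrow> real"
    have "(norm (\<Sum>b\<in>(Basis::'a set). f b *\<^sub>R b))\<^sup>2 = (\<Sum>b\<in>(Basis::'a set). (f b)\<^sup>2)"
      unfolding power2_norm_eq_inner
      by (subst euclidean_inner) (simp add: power2_eq_square)
    then show "(\<Prod>b\<in>(Basis::'a set). exp (- s * (f b)\<^sup>2))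
        = exp (- s * (norm (\<Sum>b\<in>(Basis::'a set). f b *\<^sub>R b))\<^sup>2)"
      by (simp add: exp_sum[symmetric] sum_distrib_left sum_negf)
  qed
  finally show ?thesis
    by (subst lborel_eq, subst integrable_distr_eq) auto
qed

text \<open>Half of the quadratic decay absorbs the linear terms from \<open>b\<close> and from the
  growth of \<open>g\<close>; the other half is an integrable Gaussian that dominates.\<close>

lemma integrable_gaussian_exp_growth:
  fixes g :: "'a::euclidean_space \<Rightarrow> real"
  assumes g: "exp_growth g" and s: "s > 0"
  shows "integrable lebesgue (\<lambda>y. exp (- s * (norm y)\<^sup>2 + b \<bullet> y) * g y)"
proof -
  obtain C k where C: "C \<ge> 0" "k \<ge> 0" "\<And>y. \<bar>g y\<bar> \<le> C * exp (k * norm y)"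
    using exp_growthE[OF g] by blast
  \<comment> \<open>The maximum of \<open>(norm b + k) * r - (s / 2) * r\<^sup>2\<close> over real
    \<open>r\<close>, left over from completing the square.\<close>
  define K where "K = (norm b + k)\<^sup>2 / (2 * s)"
  have bound: "\<bar>exp (- s * (norm y)\<^sup>2 + b \<bullet> y) * g y\<bar> \<le> C * exp K * exp (- (s / 2) * (norm y)\<^sup>2)" for y
  proof -
    have "0 \<le> (s * norm y - (norm b + k))\<^sup>2 / (2 * s)"
      using s by simp
    also have "\<dots> = s / 2 * (norm y)\<^sup>2 - (norm b + k) * norm y + K"
      using s by (simp add: K_def field_simps power2_eq_square)
    finally have "- s * (norm y)\<^sup>2 + norm b * norm y + k * norm y \<le> K - (s / 2) * (norm y)\<^sup>2"
      by (simp add: algebra_simps)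
    then have le: "- s * (norm y)\<^sup>2 + b \<bullet> y + k * norm y \<le> K - (s / 2) * (norm y)\<^sup>2"
      using norm_cauchy_schwarz[of b y] by linarith
    have "\<bar>exp (- s * (norm y)\<^sup>2 + b \<bullet> y) * g y\<bar>
        \<le> exp (- s * (norm y)\<^sup>2 + b \<bullet> y) * (C * exp (k * norm y))"
      unfolding abs_mult by (intro mult_mono C) auto
    also have "\<dots> = C * exp (- s * (norm y)\<^sup>2 + b \<bullet> y + k * norm y)"
      by (simp add: exp_add)
    also have "\<dots> \<le> C * exp (K - (s / 2) * (norm y)\<^sup>2)"
      using le C(1) by (intro mult_left_mono) auto
    also have "\<dots> = C * exp K * exp (- (s / 2) * (norm y)\<^sup>2)"
      by (simp add: mult.assoc mult_exp_exp)
    finally show ?thesis .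
  qed
  show ?thesis
  proof (rule Bochner_Integration.integrable_bound)
    show "integrable lebesgue (\<lambda>y::'a. C * exp K * exp (- (s / 2) * (norm y)\<^sup>2))"
      using integrable_gaussian_lborel[of "s / 2"] s
      by (intro integrable_mult_right) (subst integrable_completion, auto)
    have "(\<lambda>y. exp (- s * (norm y)\<^sup>2 + b \<bullet> y)) \<in> borel_measurable lebesgue"
      by (intro measurable_completion) auto
    then show "(\<lambda>y. exp (- s * (norm y)\<^sup>2 + b \<bullet> y) * g y) \<in> borel_measurable lebesgue"
      using g by (auto simp: exp_growth_def intro: borel_measurable_times)
    show "AE y in lebesgue. norm (exp (- s * (norm y)\<^sup>2 + b \<bullet> y) * g y)
        \<le> norm (C * exp K * exp (- (s / 2) * (norm y)\<^sup>2))"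
      using bound C(1) by (auto simp: abs_mult intro!: AE_I2) 
  qed
qed

section \<open>Differentiation of Gaussian integrals in their parameters\<close>

definition gauss_laplace :: "('a::euclidean_space \<Rightarrow> real) \<Rightarrow> real \<times> 'a \<Rightarrow> real" where
  "gauss_laplace g p = (LINT y|lebesgue. exp (- fst p * (norm y)\<^sup>2 + snd p \<bullet> y) * g y)"

text \<open>Taylor's formula with Lagrange remainder, whose intermediate point \<open>t\<close>
  satisfies \<open>\<bar>t\<bar> \<le> \<bar>w\<bar>\<close>. The factor one half is given
  away.\<close>

lemma exp_remainder_bound: "\<bar>exp w - 1 - w\<bar> \<le> w\<^sup>2 * exp \<bar>w\<bar>" for w :: real
proof -
  obtain t where t: "\<bar>t\<bar> \<le> \<bar>w\<bar>" "exp w = (\<Sum>m<2. w ^ m / fact m) + exp t / fact 2 * w ^ 2"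
    using Maclaurin_exp_le[of w 2] by blast
  have "\<bar>exp w - 1 - w\<bar> = exp t / 2 * w\<^sup>2"
    using t(2) by (simp add: numeral_2_eq_2 abs_mult)
  also have "\<dots> \<le> exp \<bar>w\<bar> * w\<^sup>2"
  proof (rule mult_right_mono)
    have "exp t \<le> exp \<bar>w\<bar>" using t(1) by simp
    then show "exp t / 2 \<le> exp \<bar>w\<bar>" using exp_gt_zero[of t] by linarith
  qed simp
  finally show ?thesis by (simp add: mult.commute)
qed

lemma quadratic_remainder_has_derivative:
  fixes f :: "'a::euclidean_space \<Rightarrow> real"
  assumes lin: "linear f'" and \<delta>: "\<delta> > 0"
    and le: "\<And>h. norm h \<le> \<delta> \<Longrightarrow> \<bar>f (p + h) - f p - f' h\<bar> \<le> K * (norm h)\<^sup>2"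
  shows "(f has_derivative f') (at p)"
  unfolding has_derivative_at
proof
  show "bounded_linear f'" using lin by (simp add: linear_conv_bounded_linear)
  show "(\<lambda>h. norm (f (p + h) - f p - f' h) / norm h) \<midarrow>0\<rightarrow> 0"
  proof (rule Lim_null_comparison)
    show "\<forall>\<^sub>F h in at 0. norm (norm (f (p + h) - f p - f' h) / norm h) \<le> K * norm h"
      unfolding eventually_at
    proof (intro exI[of _ \<delta>] conjI ballI impI \<delta>)
      fix h :: 'a assume "h \<noteq> 0 \<and> dist h 0 < \<delta>"
      then show "norm (norm (f (p + h) - f p - f' h) / norm h) \<le> K * norm h"
        using le[of h] by (simp add: divide_simps power2_eq_square mult.assoc)
    qed
    show "((\<lambda>h. K * norm h) \<longlongrightarrow> 0) (at 0)"
      by (auto intro!: tendsto_eq_intros)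
  qed
qed

text \<open>Differentiating the Gaussian exponent multiplies \<open>g\<close> by such a factor;
  staying in the class allows repeated differentiation.\<close>

lemma exp_growth_tilt:
  "exp_growth g \<Longrightarrow> exp_growth (\<lambda>y. (\<sigma> * (norm y)\<^sup>2 + b \<bullet> y) * g y)"
  by (intro exp_growth_mult exp_growth_add exp_growth_const exp_growth_norm_square exp_growth_inner)

lemma gauss_laplace_add_right:
  assumes "exp_growth g" "exp_growth h" "fst p > 0"
  shows "gauss_laplace (\<lambda>y. g y + h y) p = gauss_laplace g p + gauss_laplace h p"
  using integrable_gaussian_exp_growth[OF assms(1,3)] integrable_gaussian_exp_growth[OF assms(2,3)]
  unfolding gauss_laplace_def by (simp add: distrib_left)

lemma gauss_laplace_cmult_right:
  "gauss_laplace (\<lambda>y. c * g y) p = c * gauss_laplace g p"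
  unfolding gauss_laplace_def by (simp add: mult.left_commute)

text \<open>An increment \<open>h\<close> adds \<open>w h y\<close>, linear in \<open>h\<close>, to
  the exponent. The second-order remainder of the exponential is bounded pointwise by
  \<open>(norm h)\<^sup>2 * R y\<close> with \<open>R\<close> integrable, so the integrated
  remainder is quadratic in \<open>h\<close>.\<close>

lemma gauss_laplace_has_derivative:
  fixes g :: "'a::euclidean_space \<Rightarrow> real"
  assumes g: "exp_growth g" and p: "fst p > 0"
  shows "(gauss_laplace g has_derivative
    (\<lambda>h. gauss_laplace (\<lambda>y. (- fst h * (norm y)\<^sup>2 + snd h \<bullet> y) * g y) p)) (at p)"
proof -
  \<comment> \<open>Small enough that both \<open>fst (p + h)\<close> and the reduced decay rate
    \<open>fst p - \<delta>\<close> stay positive.\<close>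
  define \<delta> where "\<delta> = fst p / 4"
  have \<delta>: "\<delta> > 0" using p by (simp add: \<delta>_def)
  define q where "q y = - fst p * (norm y)\<^sup>2 + snd p \<bullet> y" for y
  define w where "w h y = - fst h * (norm y)\<^sup>2 + snd h \<bullet> y" for h and y :: 'a
  let ?n = "\<lambda>y::'a. (norm y)\<^sup>2 + norm y"
  \<comment> \<open>The bound on the Taylor remainder, uniform over
    \<open>norm h \<le> \<delta>\<close>, after \<open>(norm h)\<^sup>2\<close> is taken out; it
    rests on \<open>\<bar>w h y\<bar> \<le> norm h * ?n y\<close>.\<close>
  define R where "R y = exp (q y) * ((?n y)\<^sup>2 * exp (\<delta> * ?n y) * \<bar>g y\<bar>)" for y
  have int: "integrable lebesgue (\<lambda>y. exp (q y) * G y)" if "exp_growth G" for G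
    using integrable_gaussian_exp_growth[OF that p, of "snd p"] by (simp add: q_def)
  have absg: "exp_growth (\<lambda>y. \<bar>g y\<bar>)"
    using g unfolding exp_growth_def by auto
  have gnorm: "exp_growth (norm :: 'a \<Rightarrow> real)"
    by (rule exp_growth_bounded_by_exp_norm[where C = 1 and k = 1])
      (auto intro: norm_le_exp_norm continuous_intros)
  have gexp: "exp_growth (\<lambda>y::'a. exp (\<delta> * norm y))"
    by (rule exp_growth_bounded_by_exp_norm[where C = 1 and k = \<delta>]) (auto intro!: continuous_intros)
  have intR: "integrable lebesgue R"
  proof -
    \<comment> \<open>The factor \<open>exp (\<delta> * ?n y)\<close> is split: its quadratic part
      lowers the Gaussian rate to \<open>fst p - \<delta>\<close>, and its linear part counts as
      exponential growth.\<close>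
    have "exp_growth (\<lambda>y. ((?n y) * (?n y)) * exp (\<delta> * norm y) * \<bar>g y\<bar>)"
      by (intro exp_growth_mult exp_growth_add exp_growth_norm_square gnorm gexp absg)
    from integrable_gaussian_exp_growth[OF this, of "fst p - \<delta>" "snd p"]
    have "integrable lebesgue (\<lambda>y. exp (- (fst p - \<delta>) * (norm y)\<^sup>2 + snd p \<bullet> y) *
        (((?n y) * (?n y)) * exp (\<delta> * norm y) * \<bar>g y\<bar>))"
      using p by (simp add: \<delta>_def)
    moreover have "exp (- (fst p - \<delta>) * (norm y)\<^sup>2 + snd p \<bullet> y) *
        (((?n y) * (?n y)) * exp (\<delta> * norm y) * \<bar>g y\<bar>) = R y" for y
    proof -
      have "exp (- (fst p - \<delta>) * (norm y)\<^sup>2 + snd p \<bullet> y) * exp (\<delta> * norm y) = exp (q y) * exp (\<delta> * ?n y)"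
        unfolding mult_exp_exp by (simp add: q_def algebra_simps)
      moreover have "R y = (exp (q y) * exp (\<delta> * ?n y)) * (?n y * ?n y * \<bar>g y\<bar>)"
        by (simp add: R_def power2_eq_square[of "?n y"])
      ultimately show ?thesis by simp
    qed
    ultimately show ?thesis by simp
  qed
  have wle: "\<bar>w h y\<bar> \<le> norm h * ?n y" for h y
  proof -
    have "\<bar>w h y\<bar> \<le> \<bar>fst h\<bar> * (norm y)\<^sup>2 + norm (snd h) * norm y"
      unfolding w_def using Cauchy_Schwarz_ineq2[of "snd h" y]
      by (intro order_trans[OF abs_triangle_ineq] add_mono) (auto simp: abs_mult)
    also have "\<dots> \<le> norm h * (norm y)\<^sup>2 + norm h * norm y"
      using norm_fst_le[of "fst h" "snd h"] norm_snd_le[of "snd h" "fst h"]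
      by (intro add_mono mult_right_mono) auto
    finally show ?thesis by (simp add: distrib_left)
  qed
  have rem: "\<bar>gauss_laplace g (p + h) - gauss_laplace g p - gauss_laplace (\<lambda>y. w h y * g y) p\<bar>
      \<le> integral\<^sup>L lebesgue R * (norm h)\<^sup>2" if h: "norm h \<le> \<delta>" for h
  proof -
    have split: "exp (- fst (p + h) * (norm y)\<^sup>2 + snd (p + h) \<bullet> y) * g y
        = exp (q y) * (exp (w h y) * g y)" for y
    proof -
      have "- fst (p + h) * (norm y)\<^sup>2 + snd (p + h) \<bullet> y = q y + w h y"
        by (simp add: q_def w_def algebra_simps)
      then show ?thesis by (simp add: exp_add)
    qed
    have "fst (p + h) > 0"
      using h norm_fst_le[of "fst h" "snd h"] p by (simp add: \<delta>_def)
    from integrable_gaussian_exp_growth[OF g this, of "snd (p + h)"]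
    have i1: "integrable lebesgue (\<lambda>y. exp (q y) * (exp (w h y) * g y))"
      unfolding split .
    have i2: "integrable lebesgue (\<lambda>y. exp (q y) * g y)" by (rule int[OF g])
    have i3: "integrable lebesgue (\<lambda>y. exp (q y) * (w h y * g y))"
      unfolding w_def by (rule int[OF exp_growth_tilt[OF g]])
    have e1: "gauss_laplace g (p + h) = (LINT y|lebesgue. exp (q y) * (exp (w h y) * g y))"
      unfolding gauss_laplace_def split ..
    have "gauss_laplace g (p + h) - gauss_laplace g p - gauss_laplace (\<lambda>y. w h y * g y) p
       = (LINT y|lebesgue. exp (q y) * (exp (w h y) * g y) - exp (q y) * g y - exp (q y) * (w h y * g y))"
      using i1 i2 i3 by (simp add: e1) (simp add: gauss_laplace_def q_def)
    also have "\<bar>\<dots>\<bar> \<le> (LINT y|lebesgue. (norm h)\<^sup>2 * R y)"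
    proof (rule integral_abs_bound_integral)
      show "integrable lebesgue (\<lambda>y. exp (q y) * (exp (w h y) * g y) - exp (q y) * g y - exp (q y) * (w h y * g y))"
        using i1 i2 i3 by simp
      show "integrable lebesgue (\<lambda>y. (norm h)\<^sup>2 * R y)" using intR by simp
      fix y
      have "\<bar>exp (w h y) - 1 - w h y\<bar> \<le> (w h y)\<^sup>2 * exp \<bar>w h y\<bar>"
        by (rule exp_remainder_bound)
      also have "\<dots> \<le> (norm h * ?n y)\<^sup>2 * exp (\<delta> * ?n y)"
      proof (rule mult_mono)
        show "(w h y)\<^sup>2 \<le> (norm h * ?n y)\<^sup>2"
          using power_mono[OF wle[of h y], of 2] by simp
        have "norm h * ?n y \<le> \<delta> * ?n y" using h by (intro mult_right_mono) auto
        then show "exp \<bar>w h y\<bar> \<le> exp (\<delta> * ?n y)" using wle[of h y] by simp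
      qed auto
      finally have b: "\<bar>exp (w h y) - 1 - w h y\<bar> \<le> (norm h * ?n y)\<^sup>2 * exp (\<delta> * ?n y)" .
      have "\<bar>exp (q y) * (exp (w h y) * g y) - exp (q y) * g y - exp (q y) * (w h y * g y)\<bar>
        = exp (q y) * (\<bar>exp (w h y) - 1 - w h y\<bar> * \<bar>g y\<bar>)"
      proof -
        have "exp (q y) * (exp (w h y) * g y) - exp (q y) * g y - exp (q y) * (w h y * g y)
            = exp (q y) * ((exp (w h y) - 1 - w h y) * g y)"
          by (simp add: algebra_simps)
        then show ?thesis by (simp add: abs_mult)
      qed
      also have "\<dots> \<le> exp (q y) * ((norm h * ?n y)\<^sup>2 * exp (\<delta> * ?n y) * \<bar>g y\<bar>)"
        using b by (intro mult_left_mono mult_right_mono) auto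
      finally show "\<bar>exp (q y) * (exp (w h y) * g y) - exp (q y) * g y - exp (q y) * (w h y * g y)\<bar>
          \<le> (norm h)\<^sup>2 * R y"
        by (simp only: R_def power_mult_distrib mult_ac)
    qed
    finally show ?thesis by (simp add: mult.commute)
  qed
  have lin: "linear (\<lambda>h. gauss_laplace (\<lambda>y. w h y * g y) p)"
  proof (rule linearI)
    fix h k :: "real \<times> 'a"
    have "gauss_laplace (\<lambda>y. w h y * g y + w k y * g y) p
        = gauss_laplace (\<lambda>y. w h y * g y) p + gauss_laplace (\<lambda>y. w k y * g y) p"
      unfolding w_def by (intro gauss_laplace_add_right exp_growth_tilt g p)
    then show "gauss_laplace (\<lambda>y. w (h + k) y * g y) p
        = gauss_laplace (\<lambda>y. w h y * g y) p + gauss_laplace (\<lambda>y. w k y * g y) p"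
      by (simp add: w_def algebra_simps)
  next
    fix c and h :: "real \<times> 'a"
    have "(\<lambda>y. w (c *\<^sub>R h) y * g y) = (\<lambda>y. c * (w h y * g y))"
      by (simp add: w_def algebra_simps)
    then show "gauss_laplace (\<lambda>y. w (c *\<^sub>R h) y * g y) p = c *\<^sub>R gauss_laplace (\<lambda>y. w h y * g y) p"
      by (simp only: gauss_laplace_cmult_right real_scaleR_def)
  qed
  show ?thesis
    using quadratic_remainder_has_derivative[OF lin \<delta> rem] by (simp add: w_def)
qed

section \<open>The heat semigroup\<close>

text \<open>With the normalizing power inside the exponential as well, the derivative in both
  \<open>t\<close> and \<open>x\<close> reduces to that of one exponent.\<close>

lemma heat_kernel_eq_exp:
  fixes x :: "real ^ 'n"
  assumes "t > 0"
  shows "heat_kernel t x = exp (- (real CARD('n) / 2) * ln (4 * pi * t) - (x \<bullet> x) / (4 * t))"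
proof -
  have "1 / (4 * pi * t) powr (real CARD('n) / 2) = exp (- (real CARD('n) / 2) * ln (4 * pi * t))"
    using assms by (simp add: powr_def exp_minus inverse_eq_divide)
  then show ?thesis
    by (simp add: heat_kernel_def power2_norm_eq_inner mult_exp_exp)
qed

text \<open>The part of the expanded square that depends on \<open>x\<close> alone leaves the
  integral. Constant factors do so for every integrand, hence \<open>g\<close> is arbitrary
  here.\<close>

lemma heat_reg_eq_gauss_laplace:
  fixes x :: "real ^ 'n"
  assumes t: "t > 0"
  shows "heat_reg t g x = heat_kernel t x * gauss_laplace g (1 / (4 * t), (1 / (2 * t)) *\<^sub>R x)"
proof -
  have "heat_kernel t (x - y) * g y = heat_kernel t x *
      (exp (- (1 / (4 * t)) * (norm y)\<^sup>2 + ((1 / (2 * t)) *\<^sub>R x) \<bullet> y) * g y)" for y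
  proof -
    have "- ((x - y) \<bullet> (x - y)) / (4 * t)
        = - (x \<bullet> x) / (4 * t) + (- (1 / (4 * t)) * (norm y)\<^sup>2 + ((1 / (2 * t)) *\<^sub>R x) \<bullet> y)"
      using t by (simp add: power2_norm_eq_inner inner_diff inner_commute field_simps)
    then have "heat_kernel t (x - y) = heat_kernel t x *
        exp (- (1 / (4 * t)) * (norm y)\<^sup>2 + ((1 / (2 * t)) *\<^sub>R x) \<bullet> y)"
      unfolding heat_kernel_eq_exp[OF t] mult_exp_exp by simp
    then show ?thesis by simp
  qed
  then show ?thesis
    unfolding heat_reg_def gauss_laplace_def fst_conv snd_conv
    by (simp only: integral_mult_right_zero)
qed

text \<open>The logarithmic derivative of \<open>(t, x) \<mapsto> G\<^sub>t(x)\<close> at \<open>p\<close> in direction \<open>h\<close>.\<close>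

definition heat_kernel_rate :: "real \<times> (real ^ 'n) \<Rightarrow> real \<times> (real ^ 'n) \<Rightarrow> real" where
  "heat_kernel_rate p h = - (real CARD('n) / (2 * fst p)) * fst h
     + (snd p \<bullet> snd p) / (4 * (fst p)\<^sup>2) * fst h - (snd p \<bullet> snd h) / (2 * fst p)"

text \<open>The chain rule applied to the exponential form. That form is valid for positive time,
  whence the transfer on an open half-space.\<close>

lemma heat_kernel_has_derivative:
  fixes p :: "real \<times> (real ^ 'n)"
  assumes p: "fst p > 0"
  shows "((\<lambda>p. heat_kernel (fst p) (snd p)) has_derivative
    (\<lambda>h. heat_kernel_rate p h * heat_kernel (fst p) (snd p))) (at p)"
proof (rule has_derivative_transform_within_open)
  let ?A = "- (real CARD('n) / 2)"
  have "((\<lambda>p. ?A * ln (4 * pi * fst p)) has_derivative (\<lambda>h. ?A * (fst h / fst p))) (at p)"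
    by (rule derivative_eq_intros refl)+
      (use p in \<open>auto intro!: derivative_eq_intros simp: fun_eq_iff field_simps\<close>)
  moreover have "((\<lambda>p. (snd p \<bullet> snd p) / (4 * fst p)) has_derivative
      (\<lambda>h. (snd p \<bullet> snd h) / (2 * fst p) - (snd p \<bullet> snd p) / (4 * (fst p)\<^sup>2) * fst h)) (at p)"
    by (rule derivative_eq_intros refl)+
      (use p in \<open>simp_all add: fun_eq_iff divide_simps inner_commute power2_eq_square\<close>)
  ultimately have "((\<lambda>p. ?A * ln (4 * pi * fst p) - (snd p \<bullet> snd p) / (4 * fst p)) has_derivative
      heat_kernel_rate p) (at p)"
    by (rule has_derivative_eq_rhs[OF has_derivative_diff])
      (use p in \<open>simp add: fun_eq_iff heat_kernel_rate_def\<close>)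
  from has_derivative_exp[OF this]
  show "((\<lambda>p. exp (?A * ln (4 * pi * fst p) - (snd p \<bullet> snd p) / (4 * fst p))) has_derivative
      (\<lambda>h. heat_kernel_rate p h * heat_kernel (fst p) (snd p))) (at p)"
    unfolding heat_kernel_eq_exp[OF p] .
  show "open {p :: real \<times> (real ^ 'n). fst p > 0}"
    by (intro open_Collect_less continuous_intros)
qed (use p in \<open>auto simp: heat_kernel_eq_exp\<close>)

text \<open>The three summands come from the kernel factor, from \<open>s = 1 / (4 * t)\<close> and
  from \<open>b = x / (2 * t)\<close>. Only regularizations of \<open>g\<close> times a polynomial
  occur, so the same lemmas apply to the derivative again.\<close>

definition heat_reg_deriv ::
    "(real ^ 'n \<Rightarrow> real) \<Rightarrow> real \<times> (real ^ 'n) \<Rightarrow> real \<times> (real ^ 'n) \<Rightarrow> real" where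
  "heat_reg_deriv g p h = heat_kernel_rate p h * heat_reg (fst p) g (snd p)
     + fst h / (4 * (fst p)\<^sup>2) * heat_reg (fst p) (\<lambda>y. (norm y)\<^sup>2 * g y) (snd p)
     + (\<Sum>i\<in>UNIV. (snd h $ i / (2 * fst p) - fst h / (2 * (fst p)\<^sup>2) * snd p $ i)
          * heat_reg (fst p) (\<lambda>y. y $ i * g y) (snd p))"

lemma exp_growth_nth: "exp_growth (\<lambda>y::real ^ 'n. y $ i)"
  using exp_growth_inner[of "axis i (1 :: real)"] by (simp add: inner_axis')

lemma exp_growth_sum:
  "(\<And>i. i \<in> I \<Longrightarrow> exp_growth (G i)) \<Longrightarrow> exp_growth (\<lambda>y. \<Sum>i\<in>I. G i y)"
  by (induction I rule: infinite_finite_induct) (auto intro: exp_growth_const exp_growth_add)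

lemma gauss_laplace_sum:
  assumes "\<And>i. i \<in> I \<Longrightarrow> exp_growth (G i)" "fst p > 0"
  shows "gauss_laplace (\<lambda>y. \<Sum>i\<in>I. G i y) p = (\<Sum>i\<in>I. gauss_laplace (G i) p)"
  using assms
proof (induction I rule: infinite_finite_induct)
  case (insert i I)
  then show ?case
    by (simp add: gauss_laplace_add_right exp_growth_sum)
qed (auto simp: gauss_laplace_def)

text \<open>Separates the direction of differentiation, encoded in \<sigma> and \<open>b\<close>,
  from finitely many fixed integrals.\<close>

lemma gauss_laplace_tilt:
  fixes g :: "real ^ 'n \<Rightarrow> real"
  assumes g: "exp_growth g" and p: "fst p > 0"
  shows "gauss_laplace (\<lambda>y. (\<sigma> * (norm y)\<^sup>2 + b \<bullet> y) * g y) p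
    = \<sigma> * gauss_laplace (\<lambda>y. (norm y)\<^sup>2 * g y) p + (\<Sum>i\<in>UNIV. b $ i * gauss_laplace (\<lambda>y. y $ i * g y) p)"
proof -
  have G: "exp_growth (\<lambda>y. \<sigma> * ((norm y)\<^sup>2 * g y))" "\<And>i. exp_growth (\<lambda>y. b $ i * (y $ i * g y))"
    by (intro exp_growth_mult exp_growth_const exp_growth_norm_square exp_growth_nth g)+
  have "(\<lambda>y. (\<sigma> * (norm y)\<^sup>2 + b \<bullet> y) * g y)
      = (\<lambda>y. \<sigma> * ((norm y)\<^sup>2 * g y) + (\<Sum>i\<in>UNIV. b $ i * (y $ i * g y)))"
    by (simp add: fun_eq_iff inner_vec_def distrib_right sum_distrib_right mult.assoc)
  then show ?thesis
    using G by (simp add: gauss_laplace_add_right exp_growth_sum gauss_laplace_sum p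
      gauss_laplace_cmult_right)
qed

text \<open>Product rule for the kernel times the Gaussian integral, the latter composed with the
  parameter change \<open>?q\<close> whose derivative is \<open>?q'\<close>.\<close>

lemma heat_reg_has_derivative:
  fixes g :: "real ^ 'n \<Rightarrow> real"
  assumes g: "exp_growth g" and p: "fst p > 0"
  shows "((\<lambda>p. heat_reg (fst p) g (snd p)) has_derivative heat_reg_deriv g p) (at p)"
proof (rule has_derivative_transform_within_open)
  let ?q = "\<lambda>p :: real \<times> (real ^ 'n). (1 / (4 * fst p), (1 / (2 * fst p)) *\<^sub>R snd p)"
  let ?q' = "\<lambda>h :: real \<times> (real ^ 'n). (- fst h / (4 * (fst p)\<^sup>2),
     (1 / (2 * fst p)) *\<^sub>R snd h - (fst h / (2 * (fst p)\<^sup>2)) *\<^sub>R snd p)"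
  let ?E = "\<lambda>p. heat_kernel (fst p) (snd p)"
  have q: "fst (?q p) > 0" using p by simp
  have dq: "(?q has_derivative ?q') (at p)"
    by (rule derivative_eq_intros refl | use p in \<open>simp; fail\<close>)+
      (use p in \<open>simp add: fun_eq_iff field_simps power2_eq_square\<close>)
  have dL: "((\<lambda>p. gauss_laplace g (?q p)) has_derivative
    (\<lambda>h. gauss_laplace (\<lambda>y. (- fst (?q' h) * (norm y)\<^sup>2 + snd (?q' h) \<bullet> y) * g y) (?q p))) (at p)"
    by (rule has_derivative_compose[OF dq gauss_laplace_has_derivative[OF g q]])
  have "heat_reg_deriv g p h = ?E p *
      gauss_laplace (\<lambda>y. (- fst (?q' h) * (norm y)\<^sup>2 + snd (?q' h) \<bullet> y) * g y) (?q p)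
      + heat_kernel_rate p h * ?E p * gauss_laplace g (?q p)" for h
    unfolding heat_reg_deriv_def gauss_laplace_tilt[OF g q] heat_reg_eq_gauss_laplace[OF p]
    by (simp add: algebra_simps sum_distrib_left)
  then show "((\<lambda>p. ?E p * gauss_laplace g (?q p)) has_derivative heat_reg_deriv g p) (at p)"
    by (intro has_derivative_eq_rhs[OF has_derivative_mult[OF heat_kernel_has_derivative[OF p] dL]])
      (simp add: fun_eq_iff)
  show "open {p :: real \<times> (real ^ 'n). fst p > 0}"
    by (intro open_Collect_less continuous_intros)
qed (use p in \<open>auto simp: heat_reg_eq_gauss_laplace\<close>)

section \<open>Joint regularity in time and space\<close>

lemma continuous_on_heat_reg:
  fixes g :: "real ^ 'n \<Rightarrow> real"
  assumes "exp_growth g"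
  shows "continuous_on {p. fst p > 0} (\<lambda>p. heat_reg (fst p) g (snd p))"
proof (intro continuous_at_imp_continuous_on ballI)
  show "isCont (\<lambda>p. heat_reg (fst p) g (snd p)) p" if "p \<in> {p. fst p > 0}" for p
    using that by (intro has_derivative_continuous[OF heat_reg_has_derivative[OF assms]]) simp
qed

lemma continuous_on_heat_reg_deriv:
  fixes g :: "real ^ 'n \<Rightarrow> real"
  assumes g: "exp_growth g"
  shows "continuous_on {p. fst p > 0} (\<lambda>p. heat_reg_deriv g p h)"
  unfolding heat_reg_deriv_def heat_kernel_rate_def
  by (intro continuous_intros continuous_on_heat_reg exp_growth_mult exp_growth_norm_square
      exp_growth_nth g) auto

text \<open>From \<open>\<nabla>\<^sub>x G\<^sub>t(x - y) = (y - x) / (2t) G\<^sub>t(x - y)\<close>.\<close>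

definition heat_grad :: "(real ^ 'n \<Rightarrow> real) \<Rightarrow> real \<times> (real ^ 'n) \<Rightarrow> real ^ 'n" where
  "heat_grad f p = (\<chi> i. (heat_reg (fst p) (\<lambda>y. y $ i * f y) (snd p)
     - snd p $ i * heat_reg (fst p) f (snd p)) / (2 * fst p))"

text \<open>The quotient rule in each component of \<open>heat_grad\<close>. Its restriction to
  directions \<open>(0, v)\<close> is the Hessian applied to \<open>v\<close>.\<close>

definition heat_grad_deriv ::
    "(real ^ 'n \<Rightarrow> real) \<Rightarrow> real \<times> (real ^ 'n) \<Rightarrow> real \<times> (real ^ 'n) \<Rightarrow> real ^ 'n" where
  "heat_grad_deriv f p h = (\<chi> i.
     (heat_reg_deriv (\<lambda>y. y $ i * f y) p h
       - (snd h $ i * heat_reg (fst p) f (snd p) + snd p $ i * heat_reg_deriv f p h)) / (2 * fst p)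
     - fst h * (heat_reg (fst p) (\<lambda>y. y $ i * f y) (snd p)
       - snd p $ i * heat_reg (fst p) f (snd p)) / (2 * (fst p)\<^sup>2))"

lemma has_derivative_vec_lambda:
  fixes f :: "'a::real_normed_vector \<Rightarrow> 'n::finite \<Rightarrow> real"
  assumes "\<And>i. ((\<lambda>x. f x i) has_derivative (\<lambda>h. f' h i)) (at p)"
  shows "((\<lambda>x. \<chi> i. f x i) has_derivative (\<lambda>h. \<chi> i. f' h i)) (at p)"
proof (rule has_derivative_componentwise_within[THEN iffD2], rule ballI)
  fix b :: "real ^ 'n" assume "b \<in> Basis"
  then obtain i where "b = axis i 1"
    by (auto simp: Basis_vec_def)
  then show "((\<lambda>x. (\<chi> i. f x i) \<bullet> b) has_derivative (\<lambda>h. (\<chi> i. f' h i) \<bullet> b)) (at p)"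
    using assms[of i] by (simp add: inner_axis)
qed

lemma heat_grad_has_derivative:
  fixes f :: "real ^ 'n \<Rightarrow> real"
  assumes f: "exp_growth f" and p: "fst p > 0"
  shows "(heat_grad f has_derivative heat_grad_deriv f p) (at p)"
  unfolding heat_grad_def[abs_def] heat_grad_deriv_def[abs_def]
proof (rule has_derivative_vec_lambda)
  fix i
  have fi: "exp_growth (\<lambda>y. y $ i * f y)"
    by (intro exp_growth_mult exp_growth_nth f)
  have nth: "((\<lambda>p :: real \<times> (real ^ 'n). snd p $ i) has_derivative (\<lambda>h. snd h $ i)) (at p)"
    by (intro bounded_linear_imp_has_derivative bounded_linear_compose[OF bounded_linear_vec_nth]
        bounded_linear_snd)
  show "((\<lambda>p. (heat_reg (fst p) (\<lambda>y. y $ i * f y) (snd p) - snd p $ i * heat_reg (fst p) f (snd p))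
        / (2 * fst p)) has_derivative (\<lambda>h. (heat_reg_deriv (\<lambda>y. y $ i * f y) p h
       - (snd h $ i * heat_reg (fst p) f (snd p) + snd p $ i * heat_reg_deriv f p h)) / (2 * fst p)
     - fst h * (heat_reg (fst p) (\<lambda>y. y $ i * f y) (snd p)
       - snd p $ i * heat_reg (fst p) f (snd p)) / (2 * (fst p)\<^sup>2))) (at p)"
    by (rule derivative_eq_intros nth heat_reg_has_derivative[OF f p] heat_reg_has_derivative[OF fi p]
          refl | use p in \<open>simp; fail\<close>)+
      (use p in \<open>simp add: fun_eq_iff field_simps power2_eq_square\<close>)
qed

lemma continuous_on_heat_grad_deriv:
  fixes f :: "real ^ 'n \<Rightarrow> real"
  assumes f: "exp_growth f"
  shows "continuous_on {p. fst p > 0} (\<lambda>p. heat_grad_deriv f p h)"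
  unfolding heat_grad_deriv_def
  by (intro continuous_intros continuous_on_heat_reg continuous_on_heat_reg_deriv exp_growth_mult
      exp_growth_nth f) auto

section \<open>Gradient and Hessian of the heat regularization\<close>

lemma GDERIV_heat_reg:
  fixes f :: "real ^ 'n \<Rightarrow> real"
  assumes f: "exp_growth f" and t: "t > 0"
  shows "GDERIV (heat_reg t f) x :> heat_grad f (t, x)"
proof -
  have "((\<lambda>x. (t, x)) has_derivative (\<lambda>v. (0, v))) (at x)"
    by (intro has_derivative_Pair has_derivative_ident has_derivative_const)
  from has_derivative_compose[OF this, of "\<lambda>p. heat_reg (fst p) f (snd p)"]
  have "(heat_reg t f has_derivative (\<lambda>v. heat_reg_deriv f (t, x) (0, v))) (at x)"
    using heat_reg_has_derivative[OF f, of "(t, x)"] t by simp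
  moreover have "heat_reg_deriv f (t, x) (0, v) = v \<bullet> heat_grad f (t, x)" for v
    using t by (simp add: heat_reg_deriv_def heat_kernel_rate_def heat_grad_def inner_vec_def
      sum_subtractf sum_distrib_right sum_divide_distrib diff_divide_distrib algebra_simps)
      (simp add: sum_distrib_left mult_ac)
  ultimately show ?thesis by (simp add: gderiv_def)
qed

lemma gradient_eqI:
  assumes "GDERIV g x :> D"
  shows "gradient g x = D"
  unfolding gradient_def
proof (rule the_equality)
  show "D' = D" if "GDERIV g x :> D'" for D'
  proof -
    have "(\<lambda>h. h \<bullet> D') = (\<lambda>h. h \<bullet> D)"
      using that assms unfolding gderiv_def by (rule has_derivative_unique)
    then show ?thesis by (simp add: fun_eq_iff vector_eq_ldot)
  qed
qed (rule assms)

text \<open>The gradient is first identified as a function of \<open>x\<close> on the whole space,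
  since \<open>hessian\<close> differentiates that function; the slice
  \<open>x \<mapsto> (t, x)\<close> then leaves only spatial directions.\<close>

lemma hessian_heat_reg_eq_matrix:
  fixes f :: "real ^ 'n \<Rightarrow> real"
  assumes f: "exp_growth f" and t: "t > 0"
  shows "hessian (heat_reg t f) x = matrix (\<lambda>v. heat_grad_deriv f (t, x) (0, v))"
    and "linear (\<lambda>v. heat_grad_deriv f (t, x) (0, v))"
proof -
  have grad: "gradient (heat_reg t f) = (\<lambda>x. heat_grad f (t, x))"
    by (rule ext) (rule gradient_eqI[OF GDERIV_heat_reg[OF f t]])
  have "((\<lambda>x. (t, x)) has_derivative (\<lambda>v. (0, v))) (at x)"
    by (intro has_derivative_Pair has_derivative_ident has_derivative_const)
  moreover have "(heat_grad f has_derivative heat_grad_deriv f (t, x)) (at (t, x))"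
    using t by (intro heat_grad_has_derivative f) simp
  ultimately have *: "(gradient (heat_reg t f) has_derivative (\<lambda>v. heat_grad_deriv f (t, x) (0, v))) (at x)"
    unfolding grad by (rule has_derivative_compose)
  show "hessian (heat_reg t f) x = matrix (\<lambda>v. heat_grad_deriv f (t, x) (0, v))"
    unfolding hessian_def jacobian_def frechet_derivative_at[OF *, symmetric] ..
  show "linear (\<lambda>v. heat_grad_deriv f (t, x) (0, v))"
    using * has_derivative_linear by blast
qed

lemma hessian_heat_reg_mult:
  fixes f :: "real ^ 'n \<Rightarrow> real"
  assumes "exp_growth f" and "t > 0"
  shows "hessian (heat_reg t f) x *v v = heat_grad_deriv f (t, x) (0, v)"
  unfolding hessian_heat_reg_eq_matrix(1)[OF assms]
  by (rule fun_cong[OF matrix_vector_mul(2)[OF hessian_heat_reg_eq_matrix(2)[OF assms]]])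

text \<open>Symmetry is read off from the entries: entry \<open>(i, j)\<close> is the regularization
  of \<open>(y $ i - x $ i) * (y $ j - x $ j) * f y\<close> over \<open>4 * t\<^sup>2\<close>, minus
  \<open>heat_reg t f x / (2 * t)\<close> on the diagonal.\<close>

lemma transpose_hessian_heat_reg:
  fixes f :: "real ^ 'n \<Rightarrow> real"
  assumes "exp_growth f" and t: "t > 0"
  shows "transpose (hessian (heat_reg t f) x) = hessian (heat_reg t f) x"
proof -
  let ?H = "\<lambda>g. heat_reg t g x"
  have D: "heat_reg_deriv g (t, x) (0, axis j 1) = (?H (\<lambda>y. y $ j * g y) - x $ j * ?H g) / (2 * t)"
    for g j
  proof -
    have "(\<Sum>i\<in>UNIV. axis j 1 $ i / (2 * t) * ?H (\<lambda>y. y $ i * g y)) = ?H (\<lambda>y. y $ j * g y) / (2 * t)"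
      by (subst sum.remove[of _ j]) (auto simp: axis_def intro!: sum.neutral)
    then show ?thesis
      by (simp add: heat_reg_deriv_def heat_kernel_rate_def inner_axis diff_divide_distrib)
  qed
  define M where "M i j = heat_grad_deriv f (t, x) (0, axis j 1) $ i" for i j
  have M: "M i j = ((?H (\<lambda>y. y $ j * (y $ i * f y)) - x $ j * ?H (\<lambda>y. y $ i * f y)) / (2 * t)
      - (axis j 1 $ i * ?H f + x $ i * ((?H (\<lambda>y. y $ j * f y) - x $ j * ?H f) / (2 * t)))) / (2 * t)"
    for i j
    by (simp add: M_def heat_grad_deriv_def D)
  have "M i j = M j i" for i j
  proof -
    have "(\<lambda>y. y $ j * (y $ i * f y)) = (\<lambda>y. y $ i * (y $ j * f y))"
      by (simp add: mult.left_commute)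
    moreover have "axis j 1 $ i = (axis i 1 $ j :: real)"
      by (simp add: axis_def)
    ultimately show ?thesis
      unfolding M using t by (simp add: field_simps)
  qed
  then show ?thesis
    unfolding hessian_heat_reg_eq_matrix(1)[OF assms]
    by (simp add: transpose_def matrix_def vec_eq_iff M_def)
qed

text \<open>The quadratic lower bound makes \<open>f\<close> nonnegative, so the upper bound
  controls its absolute value; \<open>r \<le> exp r\<close> turns the power into an
  exponential.\<close>

lemma exp_growth_of_polynomial_tail:
  fixes f :: "real ^ 'n \<Rightarrow> real"
  assumes "f \<in> borel_measurable lebesgue" "quadratic_lower_bound f" "polynomial_tail f"
  shows "exp_growth f"
proof -
  obtain C m where C: "C > 0" "m \<ge> 2" "\<And>x. f x \<le> C * (1 + norm x powr m)"
    using assms(3) by (auto simp: polynomial_tail_def)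
  obtain c where "c > 0" "\<And>x. c * (norm x)\<^sup>2 \<le> f x"
    using assms(2) by (auto simp: quadratic_lower_bound_def)
  then have pos: "f x \<ge> 0" for x
    by (meson less_imp_le mult_nonneg_nonneg order_trans zero_le_power2)
  have "\<bar>f x\<bar> \<le> 2 * C * exp (m * norm x)" for x
  proof -
    have "norm x powr m \<le> exp (norm x) powr m"
      using norm_le_exp_norm C(2) by (intro powr_mono2) auto
    also have "\<dots> = exp (m * norm x)"
      by (simp add: powr_def)
    finally have "1 + norm x powr m \<le> 2 * exp (m * norm x)"
      using C(2) one_le_exp_iff[of "m * norm x"] by (smt (verit) mult_nonneg_nonneg norm_ge_zero)
    then have "C * (1 + norm x powr m) \<le> C * (2 * exp (m * norm x))"
      using C(1) by (intro mult_left_mono) auto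
    then show ?thesis using pos[of x] C(3)[of x] by simp
  qed
  then show ?thesis using assms(1) by (auto simp: exp_growth_def)
qed

section \<open>Implicit branches\<close>

text \<open>On a finite-dimensional domain, continuity on each fixed vector gives continuity in
  operator norm, the form used by the inverse function theorem.\<close>

lemma continuous_on_Blinfun_derivative:
  fixes DF :: "'a::euclidean_space \<Rightarrow> 'b::euclidean_space \<Rightarrow> 'c::real_normed_vector"
  assumes "\<And>p. p \<in> S \<Longrightarrow> bounded_linear (DF p)" "\<And>h. continuous_on S (\<lambda>p. DF p h)"
  shows "continuous_on S (\<lambda>p. Blinfun (DF p))"
proof (rule continuous_on_blinfun_componentwise)
  show "continuous_on S (\<lambda>p. blinfun_apply (Blinfun (DF p)) i)" for i
    using assms by (simp add: bounded_linear_Blinfun_apply cong: continuous_on_cong)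
qed

text \<open>A change of the derivative by less than \<open>\<mu> / 2\<close> in operator norm
  changes the quadratic form by at most \<open>\<mu> / 2 * (v \<bullet> v)\<close>, so half of the
  coercivity survives.\<close>

lemma coercive_neighbourhood:
  fixes DF :: "real \<times> 'a::euclidean_space \<Rightarrow> real \<times> 'a \<Rightarrow> 'a"
  assumes S: "open S" "p0 \<in> S"
    and lin: "\<And>p. p \<in> S \<Longrightarrow> bounded_linear (DF p)"
    and cont: "\<And>h. continuous_on S (\<lambda>p. DF p h)"
    and "\<mu> > 0" and coer: "\<And>v. \<mu> * (v \<bullet> v) \<le> v \<bullet> DF p0 (0, v)"
  obtains W where "open W" "p0 \<in> W" "W \<subseteq> S" "\<And>p v. p \<in> W \<Longrightarrow> \<mu> / 2 * (v \<bullet> v) \<le> v \<bullet> DF p (0, v)"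
proof -
  let ?A = "\<lambda>p. Blinfun (DF p)"
  have A: "continuous_on S ?A"
    by (intro continuous_on_Blinfun_derivative lin cont)
  then have "continuous_on S (\<lambda>p. norm (?A p - ?A p0))"
    by (intro continuous_intros)
  then have op: "open (S \<inter> (\<lambda>p. norm (?A p - ?A p0)) -` {..<\<mu> / 2})"
    using S(1) continuous_on_open_vimage[OF S(1)] by (metis Int_commute open_lessThan)
  show thesis
  proof (rule that[OF op])
    show "p0 \<in> S \<inter> (\<lambda>p. norm (?A p - ?A p0)) -` {..<\<mu> / 2}"
      using S(2) \<open>\<mu> > 0\<close> by simp
    fix p v assume "p \<in> S \<inter> (\<lambda>p. norm (?A p - ?A p0)) -` {..<\<mu> / 2}"
    then have p: "p \<in> S" "norm (?A p - ?A p0) < \<mu> / 2" by auto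
    have eq: "blinfun_apply (?A p - ?A p0) (0, v) = DF p (0, v) - DF p0 (0, v)"
      using p(1) S(2) lin by (simp add: blinfun.diff_left bounded_linear_Blinfun_apply)
    have "norm (blinfun_apply (?A p - ?A p0) (0, v)) \<le> norm (?A p - ?A p0) * norm (0 :: real, v)"
      by (rule norm_blinfun)
    also have "\<dots> \<le> \<mu> / 2 * norm v"
      using p(2) \<open>\<mu> > 0\<close> by (intro mult_mono) auto
    finally have "norm (DF p (0, v) - DF p0 (0, v)) \<le> \<mu> / 2 * norm v"
      by (simp add: eq)
    then have "norm v * norm (DF p (0, v) - DF p0 (0, v)) \<le> norm v * (\<mu> / 2 * norm v)"
      by (intro mult_left_mono) auto
    then have "\<bar>v \<bullet> (DF p (0, v) - DF p0 (0, v))\<bar> \<le> \<mu> / 2 * (v \<bullet> v)"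
      using Cauchy_Schwarz_ineq2[of v "DF p (0, v) - DF p0 (0, v)"]
      by (simp add: dot_square_norm power2_eq_square mult_ac)
    then show "\<mu> / 2 * (v \<bullet> v) \<le> v \<bullet> DF p (0, v)"
      using coer[of v] unfolding inner_diff_right by linarith
  qed auto
qed

text \<open>The inverse function theorem is applied to \<open>\<Psi> (t, x) = (t, F (t, x))\<close>,
  whose derivative is injective by coercivity. Injectivity of \<Psi> on \<open>N\<close> gives local
  uniqueness of zeros, and coercivity on \<open>N\<close> later yields nondegeneracy of the new
  branch.\<close>

lemma implicit_branch:
  fixes F :: "real \<times> 'a::euclidean_space \<Rightarrow> 'a"
  assumes S: "open S" "(T, a) \<in> S"
    and der: "\<And>p. p \<in> S \<Longrightarrow> (F has_derivative DF p) (at p)"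
    and cont: "\<And>h. continuous_on S (\<lambda>p. DF p h)"
    and F0: "F (T, a) = 0"
    and \<mu>: "\<mu> > 0" and coer: "\<And>v. \<mu> * (v \<bullet> v) \<le> v \<bullet> DF (T, a) (0, v)"
  obtains N \<epsilon> z z' where "open N" "(T, a) \<in> N" "N \<subseteq> S" "\<epsilon> > 0"
    "\<And>t. \<bar>t - T\<bar> < \<epsilon> \<Longrightarrow> (t, z t) \<in> N \<and> F (t, z t) = 0"
    "\<And>t. \<bar>t - T\<bar> < \<epsilon> \<Longrightarrow> (z has_vector_derivative z' t) (at t)"
    "\<And>t. \<bar>t - T\<bar> < \<epsilon> \<Longrightarrow> isCont z' t"
    "\<And>p v. p \<in> N \<Longrightarrow> \<mu> / 2 * (v \<bullet> v) \<le> v \<bullet> DF p (0, v)"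
    "\<And>t b. (t, b) \<in> N \<Longrightarrow> F (t, b) = 0 \<Longrightarrow> z t = b"
proof -
  have lin: "bounded_linear (DF p)" if "p \<in> S" for p
    using der[OF that] by (rule has_derivative_bounded_linear)
  obtain W where W: "open W" "(T, a) \<in> W" "W \<subseteq> S"
    "\<And>p v. p \<in> W \<Longrightarrow> \<mu> / 2 * (v \<bullet> v) \<le> v \<bullet> DF p (0, v)"
    using coercive_neighbourhood[OF S lin cont \<mu> coer] by blast
  define \<Psi> where "\<Psi> p = (fst p, F p)" for p
  define \<Psi>' where "\<Psi>' p = Blinfun (\<lambda>h. (fst h, DF p h))" for p
  have blin: "bounded_linear (\<lambda>h. (fst h, DF p h))" if "p \<in> W" for p
    using lin[of p] that W(3) by (intro bounded_linear_Pair bounded_linear_fst) auto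
  have app: "blinfun_apply (\<Psi>' p) h = (fst h, DF p h)" if "p \<in> W" for p h
    using blin[OF that] by (simp add: \<Psi>'_def bounded_linear_Blinfun_apply)
  have d\<Psi>: "(\<Psi> has_derivative blinfun_apply (\<Psi>' p)) (at p)" if "p \<in> W" for p
  proof -
    have "(\<Psi> has_derivative (\<lambda>h. (fst h, DF p h))) (at p)"
      unfolding \<Psi>_def using that W(3) by (intro has_derivative_Pair has_derivative_fst der) auto
    moreover have "blinfun_apply (\<Psi>' p) = (\<lambda>h. (fst h, DF p h))"
      using app[OF that] by blast
    ultimately show ?thesis by simp
  qed
  have c\<Psi>: "continuous_on W \<Psi>'"
    unfolding \<Psi>'_def
    by (intro continuous_on_Blinfun_derivative blin continuous_intros continuous_on_subset[OF cont W(3)])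
  have inj: "inj (blinfun_apply (\<Psi>' (T, a)))"
  proof (rule linear_injective_0[THEN iffD2, rule_format])
    show "linear (blinfun_apply (\<Psi>' (T, a)))"
      by (simp add: blinfun.bounded_linear_right bounded_linear.linear)
    show "h = 0" if "blinfun_apply (\<Psi>' (T, a)) h = 0" for h
    proof -
      have "fst h = 0" "DF (T, a) h = 0"
        using that by (auto simp: app[OF W(2)] zero_prod_def)
      then have "DF (T, a) (0, snd h) = 0" by (metis prod.collapse)
      then have "\<mu> * (snd h \<bullet> snd h) \<le> 0" using coer[of "snd h"] by simp
      then have "snd h = 0" using \<mu> by (metis inner_gt_zero_iff linorder_not_less mult_pos_pos)
      then show ?thesis using \<open>fst h = 0\<close> by (simp add: prod_eq_iff)
    qed
  qed
  \<comment> \<open>An injective linear map has a linear left inverse, which is the invertibility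
    condition the inverse function theorem asks for.\<close>
  obtain G where G: "linear G" "G \<circ> blinfun_apply (\<Psi>' (T, a)) = id"
    using linear_injective_left_inverse[OF _ inj]
    by (metis blinfun.bounded_linear_right bounded_linear.linear)
  then have inv: "Blinfun G o\<^sub>L \<Psi>' (T, a) = id_blinfun"
    by (intro blinfun_eqI)
      (auto simp: bounded_linear_Blinfun_apply linear_conv_bounded_linear fun_eq_iff)
  obtain N V g g' where N: "open N" "N \<subseteq> W" "(T, a) \<in> N" "open V" "\<Psi> (T, a) \<in> V"
    and hom: "homeomorphism N V \<Psi> g"
    and g: "\<And>y. y \<in> V \<Longrightarrow> (g has_derivative (g' y)) (at y)"
      "\<And>y. y \<in> V \<Longrightarrow> g' y = inv (blinfun_apply (\<Psi>' (g y)))"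
      "\<And>y. y \<in> V \<Longrightarrow> bij (blinfun_apply (\<Psi>' (g y)))"
  proof (rule inverse_function_theorem[OF W(1) _ c\<Psi> W(2) inv])
    show "(\<Psi> has_derivative blinfun_apply (\<Psi>' p)) (at p)" if "p \<in> W" for p
      by (rule d\<Psi>[OF that])
    fix N V g g'
    assume h: "open N" "N \<subseteq> W" "(T, a) \<in> N" "open V" "\<Psi> (T, a) \<in> V" "homeomorphism N V \<Psi> g"
      "\<And>y. y \<in> V \<Longrightarrow> (g has_derivative (g' y)) (at y)"
      "\<And>y. y \<in> V \<Longrightarrow> g' y = inv (blinfun_apply (\<Psi>' (g y)))"
      "\<And>y. y \<in> V \<Longrightarrow> bij (blinfun_apply (\<Psi>' (g y)))"
    show thesis by (rule that[of N V g g', OF h])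
  qed
  have "(T, 0) \<in> V"
    using N(5) F0 by (simp add: \<Psi>_def)
  then obtain \<epsilon> where \<epsilon>: "\<epsilon> > 0" "ball (T, 0) \<epsilon> \<subseteq> V"
    using N(4) openE by blast
  \<comment> \<open>The local inverse \<open>g\<close> sends \<open>(t, 0)\<close> to the only zero
    of \<open>F\<close> in \<open>N\<close> with time coordinate \<open>t\<close>.\<close>
  define z where "z t = snd (g (t, 0))" for t
  define z' where "z' t = snd (g' (t, 0) (1, 0))" for t
  have inV: "(t, 0) \<in> V" if "\<bar>t - T\<bar> < \<epsilon>" for t
    using that \<epsilon>(2) by (auto simp: subset_iff dist_Pair_Pair dist_real_def abs_minus_commute)
  have gt: "g (t, 0) = (t, z t)" "(t, z t) \<in> N" "F (t, z t) = 0" if "\<bar>t - T\<bar> < \<epsilon>" for t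
  proof -
    have "\<Psi> (g (t, 0)) = (t, 0)" "g (t, 0) \<in> N"
      using inV[OF that] hom by (auto simp: homeomorphism_def)
    then show "g (t, 0) = (t, z t)" "(t, z t) \<in> N" "F (t, z t) = 0"
      by (auto simp: \<Psi>_def z_def prod_eq_iff) (metis prod.collapse)+
  qed
  have dz: "(z has_vector_derivative z' t) (at t)" if t: "\<bar>t - T\<bar> < \<epsilon>" for t
  proof -
    have i: "((\<lambda>t. (t, 0)) has_derivative (\<lambda>\<tau>. (\<tau>, 0))) (at t)"
      by (intro has_derivative_Pair has_derivative_ident has_derivative_const)
    have "((\<lambda>t. g (t, 0)) has_derivative (\<lambda>\<tau>. g' (t, 0) (\<tau>, 0))) (at t)"
      using has_derivative_compose[OF i g(1)[OF inV[OF t]]] .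
    then have d: "(z has_derivative (\<lambda>\<tau>. snd (g' (t, 0) (\<tau>, 0)))) (at t)"
      unfolding z_def by (rule has_derivative_snd)
    have "g' (t, 0) (\<tau>, 0) = \<tau> *\<^sub>R g' (t, 0) (1, 0)" for \<tau>
    proof -
      have "linear (g' (t, 0))"
        using g(1)[OF inV[OF t]] has_derivative_linear by blast
      from linear_scale[OF this, of \<tau> "(1, 0)"] show ?thesis by simp
    qed
    then show ?thesis
      using d unfolding has_vector_derivative_def z'_def by (metis (no_types, lifting) ext snd_scaleR)
  qed
  \<comment> \<open>The differentiated equation \<open>F (t, z t) = 0\<close>, obtained here from
    \<open>g'\<close> being the inverse of the derivative of \<Psi>.\<close>
  have z'eq: "DF (t, z t) (1, z' t) = 0" if t: "\<bar>t - T\<bar> < \<epsilon>" for t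
  proof -
    have "blinfun_apply (\<Psi>' (t, z t)) (g' (t, 0) (1, 0)) = (1, 0)"
      using g(2,3)[OF inV[OF t]] by (metis bij_inv_eq_iff gt(1)[OF t])
    moreover have "(t, z t) \<in> W" using gt(2)[OF t] N(2) by auto
    ultimately have "fst (g' (t, 0) (1, 0)) = 1" "DF (t, z t) (g' (t, 0) (1, 0)) = 0"
      by (auto simp: app)
    then show ?thesis unfolding z'_def by (metis prod.collapse)
  qed
  have cz': "isCont z' t0" if t0: "\<bar>t0 - T\<bar> < \<epsilon>" for t0
  proof -
    have near: "\<forall>\<^sub>F t in at t0. \<bar>t - T\<bar> < \<epsilon>"
    proof -
      have "open {t. \<bar>t - T\<bar> < \<epsilon>}" by (intro open_Collect_less continuous_intros)
      then show ?thesis using t0 eventually_at_topological[of "\<lambda>t. \<bar>t - T\<bar> < \<epsilon>"] by blast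
    qed
    \<comment> \<open>Apply \<open>DF (t, z t)\<close> to \<open>(1, z' t) - (1, z' t0)\<close>, where the first vector is in its kernel, and use coercivity.\<close>
    have bnd: "norm (z' t - z' t0) \<le> (2 / \<mu>) * norm (DF (t, z t) (1, z' t0))"
      if t: "\<bar>t - T\<bar> < \<epsilon>" for t
    proof -
      define w where "w = z' t - z' t0"
      have tW: "(t, z t) \<in> W" using gt(2)[OF t] N(2) by auto
      then have "linear (DF (t, z t))"
        using lin W(3) by (auto intro: bounded_linear.linear)
      from linear_diff[OF this, of "(1, z' t)" "(1, z' t0)"]
      have "DF (t, z t) (0, w) = - DF (t, z t) (1, z' t0)"
        using z'eq[OF t] by (simp add: w_def)
      then have "\<mu> / 2 * (w \<bullet> w) \<le> norm w * norm (DF (t, z t) (1, z' t0))"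
        using W(4)[OF tW, of w] norm_cauchy_schwarz[of w "DF (t, z t) (0, w)"] by simp
      then have "norm w * (\<mu> / 2 * norm w) \<le> norm w * norm (DF (t, z t) (1, z' t0))"
        by (simp add: dot_square_norm power2_eq_square mult_ac)
      then have "\<mu> / 2 * norm w \<le> norm (DF (t, z t) (1, z' t0))"
        by (cases "w = 0") auto
      then show ?thesis using \<mu> by (simp add: w_def field_simps)
    qed
    have "isCont z t0"
      using dz[OF t0] has_vector_derivative_continuous by blast
    moreover have "isCont (\<lambda>p. DF p (1, z' t0)) (t0, z t0)"
      using cont[of "(1, z' t0)"] gt(2)[OF t0] N(2) W(3) S(1) continuous_on_eq_continuous_at by blast
    moreover have "isCont (\<lambda>t. (t, z t)) t0"
      using \<open>isCont z t0\<close> by (intro isCont_Pair) auto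
    ultimately have "isCont (\<lambda>t. DF (t, z t) (1, z' t0)) t0"
      using isCont_o2[of t0 "\<lambda>t. (t, z t)" "\<lambda>p. DF p (1, z' t0)"] by blast
    \<comment> \<open>The limit of the bound is zero because \<open>z'eq\<close> at
      \<open>t0\<close> says that \<open>(1, z' t0)\<close> lies in the kernel there.\<close>
    then have "((\<lambda>t. (2 / \<mu>) * norm (DF (t, z t) (1, z' t0))) \<longlongrightarrow> (2 / \<mu>) * norm (0 :: 'a)) (at t0)"
      unfolding isCont_def z'eq[OF t0] by (intro tendsto_intros)
    then have "((\<lambda>t. z' t - z' t0) \<longlongrightarrow> 0) (at t0)"
      by (intro Lim_null_comparison[OF eventually_mono[OF near bnd]]) auto
    then show ?thesis
      unfolding isCont_def using LIM_zero_iff by blast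
  qed
  show thesis
  proof (rule that[OF N(1,3) _ \<epsilon>(1), of z z'])
    show "N \<subseteq> S" using N(2) W(3) by auto
    show "z t = b" if "(t, b) \<in> N" "F (t, b) = 0" for t b
      using homeomorphism_apply1[OF hom that(1)] that(2) by (simp add: \<Psi>_def z_def)
  qed (use gt dz cz' W(4) N(2) in auto)
qed

section \<open>Continuation of branches\<close>

text \<open>On an open interval derivatives within the set are ordinary ones, gradients are unique,
  and the Hessian is always symmetric; only the sign of its least eigenvalue remains of positive
  definiteness.\<close>

lemma nondeg_min_branch_heat_reg_iff:
  fixes f :: "real ^ 'n \<Rightarrow> real"
  assumes f: "exp_growth f"
  shows "nondeg_min_branch f {0<..<T} x \<longleftrightarrow>
     (\<exists>x'. (\<forall>t\<in>{0<..<T}. (x has_vector_derivative x' t) (at t)) \<and> continuous_on {0<..<T} x') \<and>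
     (\<forall>t\<in>{0<..<T}. heat_grad f (t, x t) = 0 \<and> 0 < lambda_min (hessian (heat_reg t f) (x t)))"
proof -
  have grad: "GDERIV (heat_reg t f) y :> 0 \<longleftrightarrow> heat_grad f (t, y) = 0" if "t > 0" for t y
    using GDERIV_heat_reg[OF f that, of y] gradient_eqI by metis
  have der: "(\<forall>t\<in>{0<..<T}. (x has_vector_derivative x' t) (at t within {0<..<T})) \<longleftrightarrow>
      (\<forall>t\<in>{0<..<T}. (x has_vector_derivative x' t) (at t))" for x'
    by (intro ball_cong refl) (simp add: at_within_open[OF _ open_greaterThanLessThan])
  have crit: "(\<forall>t\<in>{0<..<T}. GDERIV (heat_reg t f) (x t) :> 0)
      \<longleftrightarrow> (\<forall>t\<in>{0<..<T}. heat_grad f (t, x t) = 0)"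
    by (intro ball_cong refl grad) simp
  have pos: "(\<forall>t\<in>{0<..<T}. pos_definite (hessian (heat_reg t f) (x t)))
      \<longleftrightarrow> (\<forall>t\<in>{0<..<T}. 0 < lambda_min (hessian (heat_reg t f) (x t)))"
    by (intro ball_cong refl) (simp add: pos_definite_iff_lambda_min transpose_hessian_heat_reg[OF f])
  have "is_interval {0<..<T}" "{0<..<T} \<subseteq> {0<..}"
    by (auto simp: is_interval_oo)
  then show ?thesis
    unfolding nondeg_min_branch_def critical_branch_def der crit pos by blast
qed

text \<open>For each fixed \<open>v\<close> the right-hand inequality is a closed condition in
  \<open>(t, x)\<close>, so eigenvalue bounds pass to limits along the branch; it is also the
  coercivity used for the implicit branch.\<close>

lemma lambda_min_hessian_ge_iff:
  fixes f :: "real ^ 'n \<Rightarrow> real"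
  assumes f: "exp_growth f" and t: "t > 0"
  shows "\<mu> \<le> lambda_min (hessian (heat_reg t f) x) \<longleftrightarrow>
    (\<forall>v. \<mu> * (v \<bullet> v) \<le> v \<bullet> heat_grad_deriv f (t, x) (0, v))"
proof
  assume le: "\<mu> \<le> lambda_min (hessian (heat_reg t f) x)"
  show "\<forall>v. \<mu> * (v \<bullet> v) \<le> v \<bullet> heat_grad_deriv f (t, x) (0, v)"
  proof
    fix v :: "real ^ 'n"
    have "\<mu> * (v \<bullet> v) \<le> lambda_min (hessian (heat_reg t f) x) * (v \<bullet> v)"
      using le by (intro mult_right_mono) auto
    also have "\<dots> \<le> v \<bullet> heat_grad_deriv f (t, x) (0, v)"
      using lambda_min_le_rayleigh[OF transpose_hessian_heat_reg[OF f t]]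
      by (simp add: hessian_heat_reg_mult[OF f t])
    finally show "\<mu> * (v \<bullet> v) \<le> v \<bullet> heat_grad_deriv f (t, x) (0, v)" .
  qed
next
  assume "\<forall>v. \<mu> * (v \<bullet> v) \<le> v \<bullet> heat_grad_deriv f (t, x) (0, v)"
  then show "\<mu> \<le> lambda_min (hessian (heat_reg t f) x)"
    by (intro lambda_min_ge transpose_hessian_heat_reg f t) (simp add: hessian_heat_reg_mult[OF f t])
qed

section \<open>Both directions of the equivalence for a branch with a left limit\<close>

context
  fixes f :: "real ^ 'n \<Rightarrow> real" and T :: real and x :: "real \<Rightarrow> real ^ 'n" and a :: "real ^ 'n"
  assumes f: "exp_growth f" and T: "0 < T" and x: "nondeg_min_branch f {0<..<T} x"
    and lim: "(x \<longlongrightarrow> a) (at_left T)"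
begin

lemma open_halfspace: "open {p :: real \<times> (real ^ 'n). fst p > 0}"
  by (intro open_Collect_less continuous_intros)

lemma branch_tendsto: "((\<lambda>t. (t, x t)) \<longlongrightarrow> (T, a)) (at_left T)"
  by (intro tendsto_Pair lim tendsto_ident_at)

lemma eventually_in_interval: "\<forall>\<^sub>F t in at_left T. t \<in> {0<..<T}"
  using T by (rule eventually_at_leftI[rotated]) simp

text \<open>Continuity of the extension at \<open>T\<close> forces its value there to be
  \<open>a\<close>, so the Hessian at \<open>(T, a)\<close> is positive definite; half of its
  coercivity constant bounds the eigenvalues for \<open>t\<close> close to \<open>T\<close>.\<close>

lemma liminf_pos_if_extends:
  assumes "extends_across f T x"
  shows "0 < Liminf (at_left T) (\<lambda>t. ereal (lambda_min (hessian (heat_reg t f) (x t))))"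
proof -
  obtain e y where e: "e > 0" and y: "nondeg_min_branch f {0<..<T + e} y"
    and eq: "\<And>t. t \<in> {0<..<T} \<Longrightarrow> y t = x t"
    using assms by (auto simp: extends_across_def)
  have "(y \<longlongrightarrow> y T) (at_left T)"
  proof -
    have "isCont y T"
      using y e T unfolding nondeg_min_branch_heat_reg_iff[OF f]
      by (auto intro: has_vector_derivative_continuous)
    then show ?thesis
      by (meson isCont_def tendsto_within_subset top_greatest)
  qed
  then have "(x \<longlongrightarrow> y T) (at_left T)"
    by (rule Lim_transform_eventually) (auto intro: eventually_mono[OF eventually_in_interval] simp: eq)
  then have "y T = a"
    using lim by (intro tendsto_unique[of "at_left T"]) auto
  define \<mu> where "\<mu> = lambda_min (hessian (heat_reg T f) a)"
  have \<mu>: "\<mu> > 0"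
    using y e T \<open>y T = a\<close> unfolding nondeg_min_branch_heat_reg_iff[OF f] \<mu>_def by force
  have coer: "\<And>v. \<mu> * (v \<bullet> v) \<le> v \<bullet> heat_grad_deriv f (T, a) (0, v)"
    using lambda_min_hessian_ge_iff[OF f T, of \<mu> a] by (simp add: \<mu>_def)
  have lin: "bounded_linear (heat_grad_deriv f p)" if "p \<in> {p. fst p > 0}" for p
    using that by (intro has_derivative_bounded_linear[OF heat_grad_has_derivative[OF f]]) simp
  have Ta: "(T, a) \<in> {p. fst p > 0}" using T by simp
  obtain W where W: "open W" "(T, a) \<in> W" "W \<subseteq> {p. fst p > 0}"
    "\<And>p v. p \<in> W \<Longrightarrow> \<mu> / 2 * (v \<bullet> v) \<le> v \<bullet> heat_grad_deriv f p (0, v)"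
    using coercive_neighbourhood[OF open_halfspace Ta lin continuous_on_heat_grad_deriv[OF f] \<mu> coer]
    by blast
  have "\<forall>\<^sub>F t in at_left T. (t, x t) \<in> W"
    by (rule topological_tendstoD[OF branch_tendsto W(1,2)])
  then have "\<forall>\<^sub>F t in at_left T. ereal (\<mu> / 2) \<le> ereal (lambda_min (hessian (heat_reg t f) (x t)))"
    using eventually_in_interval
  proof eventually_elim
    case (elim t)
    then show ?case
      using W(4) lambda_min_hessian_ge_iff[OF f, of t "\<mu> / 2" "x t"] by simp
  qed
  then have "ereal (\<mu> / 2) \<le> Liminf (at_left T) (\<lambda>t. ereal (lambda_min (hessian (heat_reg t f) (x t))))"
    by (rule Liminf_bounded)
  moreover have "0 < ereal (\<mu> / 2)"
    using \<mu> by simp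
  ultimately show ?thesis
    by (rule less_le_trans[rotated])
qed

text \<open>The critical point equation and the coercivity bound both pass to the limit
  \<open>(T, a)\<close>. The implicit branch through this point agrees with \<open>x\<close> shortly
  before \<open>T\<close>, and the two are glued.\<close>

lemma extends_if_liminf_pos:
  assumes "0 < Liminf (at_left T) (\<lambda>t. ereal (lambda_min (hessian (heat_reg t f) (x t))))"
  shows "extends_across f T x"
proof -
  \<comment> \<open>A real number strictly below the limit inferior is an eventual lower
    bound.\<close>
  obtain \<mu> where \<mu>: "\<mu> > 0"
    and less: "ereal \<mu> < Liminf (at_left T) (\<lambda>t. ereal (lambda_min (hessian (heat_reg t f) (x t))))"
    using ereal_dense2[OF assms] by auto
  have ev: "\<forall>\<^sub>F t in at_left T. \<mu> \<le> lambda_min (hessian (heat_reg t f) (x t))"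
    using less_LiminfD[OF less] by (rule eventually_mono) simp
  have Ta: "(T, a) \<in> {p. fst p > 0}" using T by simp
  have lim_comp: "((\<lambda>t. G (t, x t)) \<longlongrightarrow> G (T, a)) (at_left T)"
    if "continuous_on {p. fst p > 0} G" for G :: "real \<times> (real ^ 'n) \<Rightarrow> real ^ 'n"
    using that Ta continuous_on_eq_continuous_at[OF open_halfspace]
    by (intro isCont_tendsto_compose[OF _ branch_tendsto]) blast
  have der: "(heat_grad f has_derivative heat_grad_deriv f p) (at p)" if "p \<in> {p. fst p > 0}" for p
    using heat_grad_has_derivative[OF f] that by simp
  have coer: "\<mu> * (v \<bullet> v) \<le> v \<bullet> heat_grad_deriv f (T, a) (0, v)" for v
  proof (rule tendsto_lowerbound)
    show "((\<lambda>t. v \<bullet> heat_grad_deriv f (t, x t) (0, v)) \<longlongrightarrow> v \<bullet> heat_grad_deriv f (T, a) (0, v)) (at_left T)"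
      by (intro tendsto_inner tendsto_const lim_comp continuous_on_heat_grad_deriv f)
    show "\<forall>\<^sub>F t in at_left T. \<mu> * (v \<bullet> v) \<le> v \<bullet> heat_grad_deriv f (t, x t) (0, v)"
      using ev eventually_in_interval
      by eventually_elim (use lambda_min_hessian_ge_iff[OF f] in auto)
  qed auto
  obtain x' where x': "\<And>t. t \<in> {0<..<T} \<Longrightarrow> (x has_vector_derivative x' t) (at t)"
      "continuous_on {0<..<T} x'"
    and crit: "\<And>t. t \<in> {0<..<T} \<Longrightarrow> heat_grad f (t, x t) = 0"
    and pos: "\<And>t. t \<in> {0<..<T} \<Longrightarrow> 0 < lambda_min (hessian (heat_reg t f) (x t))"
    using x unfolding nondeg_min_branch_heat_reg_iff[OF f] by blast
  have "heat_grad f (T, a) = 0"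
  proof (rule tendsto_unique)
    show "((\<lambda>t. heat_grad f (t, x t)) \<longlongrightarrow> heat_grad f (T, a)) (at_left T)"
      by (intro lim_comp continuous_at_imp_continuous_on ballI has_derivative_continuous[OF der])
    show "((\<lambda>t. heat_grad f (t, x t)) \<longlongrightarrow> 0) (at_left T)"
      by (rule tendsto_eventually, rule eventually_mono[OF eventually_in_interval]) (rule crit)
  qed simp
  from implicit_branch[OF open_halfspace Ta der continuous_on_heat_grad_deriv[OF f] this \<mu> coer]
  obtain N \<epsilon> z z' where N: "open N" "(T, a) \<in> N" "N \<subseteq> {p. fst p > 0}" and \<epsilon>: "\<epsilon> > 0"
    and z: "\<And>t. \<bar>t - T\<bar> < \<epsilon> \<Longrightarrow> (t, z t) \<in> N \<and> heat_grad f (t, z t) = 0"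
      "\<And>t. \<bar>t - T\<bar> < \<epsilon> \<Longrightarrow> (z has_vector_derivative z' t) (at t)"
      "\<And>t. \<bar>t - T\<bar> < \<epsilon> \<Longrightarrow> isCont z' t"
    and coerN: "\<And>p v. p \<in> N \<Longrightarrow> \<mu> / 2 * (v \<bullet> v) \<le> v \<bullet> heat_grad_deriv f p (0, v)"
    and unique: "\<And>t b. (t, b) \<in> N \<Longrightarrow> heat_grad f (t, b) = 0 \<Longrightarrow> z t = b"
    by blast
  \<comment> \<open>Near \<open>T\<close> the given branch lies in \<open>N\<close> and solves the
    same equation, so local uniqueness applies.\<close>
  have "\<forall>\<^sub>F t in at_left T. z t = x t"
    using topological_tendstoD[OF branch_tendsto N(1,2)] eventually_in_interval
    by eventually_elim (use unique crit in blast)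
  then obtain s where s: "s < T" "\<And>t. s < t \<Longrightarrow> t < T \<Longrightarrow> z t = x t"
    by (auto simp: eventually_at_left_field)
  \<comment> \<open>On \<open>(r, T)\<close> the implicit branch is defined, agrees with
    \<open>x\<close>, and all times are positive.\<close>
  define r where "r = max (max s (T - \<epsilon>)) 0"
  have r: "r < T" "\<And>t. r < t \<Longrightarrow> t < T \<Longrightarrow> z t = x t" "0 \<le> r" "T - \<epsilon> \<le> r"
    using s T \<epsilon> by (auto simp: r_def)
  \<comment> \<open>At \<open>T\<close> itself the value is taken from \<open>z\<close>, since
    \<open>x T\<close> is unconstrained.\<close>
  define y where "y t = (if t < T then x t else z t)" for t
  define y' where "y' t = (if t < T then x' t else z' t)" for t
  have yx: "y t = x t" if "t < T" for t using that by (simp add: y_def)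
  have yz: "y t = z t" if "r < t" for t using that r(2) by (auto simp: y_def)
  have eqd: "x' t = z' t" if "t \<in> {r<..<T}" for t
  proof (rule vector_derivative_unique_at)
    show "(x has_vector_derivative x' t) (at t)" using that r by (intro x') auto
    have "(z has_vector_derivative z' t) (at t)" using that r by (intro z(2)) auto
    then show "(x has_vector_derivative z' t) (at t)"
      by (rule has_vector_derivative_transform_within_open[where S = "{r<..<T}"]) (use that r in auto)
  qed
  have yx': "y' t = x' t" if "t < T" for t using that by (simp add: y'_def)
  have yz': "y' t = z' t" if "r < t" for t using that eqd by (auto simp: y'_def)
  \<comment> \<open>The two open intervals overlap in \<open>(r, T)\<close>, so regularity is
    checked on each of them and no one-sided derivatives have to be matched at
    \<open>T\<close>.\<close>
  have cover: "t \<in> {0<..<T} \<or> t \<in> {r<..<T + \<epsilon>}" if "t \<in> {0<..<T + \<epsilon>}" for t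
    using that r(1) by auto
  have "nondeg_min_branch f {0<..<T + \<epsilon>} y"
    unfolding nondeg_min_branch_heat_reg_iff[OF f]
  proof (intro conjI exI[of _ y'] ballI)
    fix t assume t: "t \<in> {0<..<T + \<epsilon>}"
    from cover[OF t] show "(y has_vector_derivative y' t) (at t)"
    proof
      assume t: "t \<in> {0<..<T}"
      show ?thesis
        by (rule has_vector_derivative_transform_within_open[where S = "{0<..<T}" and f = x])
          (use t x'(1)[OF t] yx yx' in auto)
    next
      assume t: "t \<in> {r<..<T + \<epsilon>}"
      show ?thesis
        by (rule has_vector_derivative_transform_within_open[where S = "{r<..<T + \<epsilon>}" and f = z])
          (use t z(2)[of t] yz yz' r in \<open>auto simp: abs_less_iff\<close>)
    qed
    from cover[OF t] show "heat_grad f (t, y t) = 0"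
      using crit z(1) yx yz r by (auto simp: abs_less_iff)
    from cover[OF t] show "0 < lambda_min (hessian (heat_reg t f) (y t))"
    proof
      assume "t \<in> {0<..<T}" then show ?thesis using pos yx by auto
    next
      assume "t \<in> {r<..<T + \<epsilon>}"
      then have "(t, y t) \<in> N" using z(1) yz r by (auto simp: abs_less_iff)
      then have "\<mu> / 2 \<le> lambda_min (hessian (heat_reg t f) (y t))"
        using coerN[of "(t, y t)"] N(3) lambda_min_hessian_ge_iff[OF f, of t "\<mu> / 2" "y t"] by auto
      then show ?thesis using \<mu> by linarith
    qed
  next
    show "continuous_on {0<..<T + \<epsilon>} y'"
    proof -
      have 1: "continuous_on {0<..<T} y'"
        using x'(2) by (rule continuous_on_eq) (simp add: yx')
      have "continuous_on {r<..<T + \<epsilon>} z'"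
        using z(3) r by (intro continuous_at_imp_continuous_on) (auto simp: abs_less_iff)
      then have 2: "continuous_on {r<..<T + \<epsilon>} y'"
        by (rule continuous_on_eq) (simp add: yz')
      have "{0<..<T + \<epsilon>} = {0<..<T} \<union> {r<..<T + \<epsilon>}"
        using r T \<epsilon> by auto
      then show ?thesis
        using continuous_on_open_Un[OF _ _ 1 2] by simp
    qed
  qed
  then show ?thesis
    unfolding extends_across_def using \<epsilon> yx
    by (intro exI[of _ \<epsilon>] conjI exI[of _ y]) auto
qed

text \<open>All least eigenvalues along the branch are positive. For a maximal branch this turns
  failure of a positive limit inferior into the value zero.\<close>

lemma liminf_nonneg:
  "0 \<le> Liminf (at_left T) (\<lambda>t. ereal (lambda_min (hessian (heat_reg t f) (x t))))"
  using x unfolding nondeg_min_branch_heat_reg_iff[OF f]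
  by (intro Liminf_bounded eventually_mono[OF eventually_in_interval]) (auto intro: less_imp_le)

end

theorem theorem4p12:
  fixes f :: "real ^ 'n \<Rightarrow> real"
    and T_max :: real
    and x :: "real \<Rightarrow> real ^ 'n"
    and x_bar :: "real ^ 'n"
  assumes "f \<in> borel_measurable lebesgue"
    and "quadratic_lower_bound f"
    and "local_profile f"
    and "polynomial_tail f"
    and "0 < T_max"
    and "nondeg_min_branch f {0<..<T_max} x"
    and "(x \<longlongrightarrow> x_bar) (at_left T_max)"
  shows "(extends_across f T_max x \<longleftrightarrow>
           0 < Liminf (at_left T_max) (\<lambda>t. ereal (lambda_min (hessian (heat_reg t f) (x t))))) \<and>
         (maximal_branch f T_max x \<longrightarrow>
           Liminf (at_left T_max) (\<lambda>t. ereal (lambda_min (hessian (heat_reg t f) (x t)))) = 0)"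
proof -
  have f: "exp_growth f"
    using assms(1,2,4) by (rule exp_growth_of_polynomial_tail)
  note extends_iff = liminf_pos_if_extends[OF f assms(5-7)] extends_if_liminf_pos[OF f assms(5-7)]
  show ?thesis
    \<comment> \<open>Maximality excludes an extension, so the limit inferior is not positive; being
      nonnegative, it is zero.\<close>
    using extends_iff liminf_nonneg[OF f assms(5-7)]
    by (auto simp: maximal_branch_def order.order_iff_strict)
qed

end
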